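(* Let $\theta_0\in\Theta$ be the true regression function and let the prior $\Pi$ on $\Theta$ satisfy assumption (A) (all defined in the context). Put $\epsilon_n=(\log n)^{1/2}/n^{1/2}$. Then for all sufficiently large constants $M$, $$\Pi^n\big(\theta\in\Theta:\ \|\theta-\theta_0\|>M\epsilon_n\big)\to 0\quad\text{in } P_0^n\text{-probability as } n\to\infty .$$
   Context: Model space. Fix an integer $k_{max}\ge 1$ and $K>0$. For $k\ge1$ let $T_k$ be the set of tuples $t=(t_0,\dots,t_k)$ with $0=t_0<t_1<\dots<t_k=1$ (identified with a subset of $\mathbb{R}^{k-1}$ through $(t_1,\dots,t_{k-1})$). A pair $(a,t)\in[-K,K]^k\times T_k$ is identified with the step function $\theta(x)=\sum_{j=1}^k a_j I(t_{j-1}\le x<t_j)$ on $[0,1)$. $\Theta_k$ is the set of such $\theta=(a,t)$ ("functions with $k$ change-points", i.e. $k$ segments), and $\Theta=\bigcup_{k=1}^{k_{max}}\Theta_k$. The norm is $\|\theta\|=(\int_0^1\theta^2(x)\,dx)^{1/2}$. Data. One observes i.i.d. $Z_i=(X_i,Y_i)$, $i=1,\dots,n$, with $X_i$ uniform on $[0,1)$ and $Y_i=\theta_0(X_i)+\varepsilon_i$, where the $\varepsilon_i\sim N(0,1)$ are i.i.d. and independent of the $X_i$. The true function is $\theta_0=\sum_{j=1}^{k_0}a_j^0I(t_{j-1}^0\le x<t_j^0)\in\Theta_{k_0}\subset\Theta$, $k_0\le k_{max}$, with $a_j^0\ne a_{j-1}^0$ for $2\le j\le k_0$. $P_\theta$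 is the law of one observation under $\theta$, with density $p_\theta$; $P_0=P_{\theta_0}$, and $P_0^n$ is the law of $(Z_1,\dots,Z_n)$ under $\theta_0$. Prior. $\Pi=\sum_{k=1}^{k_{max}}p(k)\Pi_k$ with $p(k)>0$, $\sum_kp(k)=1$, where $\Pi_k$ is a probability measure on $\Theta_k$ with density $\pi_k(a,t)=\pi_k^a(a|t)\pi_k^t(t)$ with respect to Lebesgue measure. Assumption (A): for each $k$, the densities $\pi_k^a(a|t)$ and $\pi_k^t(t)$ are bounded away from zero and infinity on $[-K,K]^k$ and $T_k$ respectively. Posterior. $\Pi^n(A)=\int_A\prod_{i=1}^np_\theta(Z_i)\,d\Pi(\theta)\big/\int\prod_{i=1}^np_\theta(Z_i)\,d\Pi(\theta)$. *)

theory Defs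
  imports "HOL-Probability.Probability"
begin

text \<open>
  The inner change-points \<open>(t\<^sub>1, \<dots>, t\<^sub>k\<^sub>-\<^sub>1)\<close> are stored as an extensional function on
  \<open>{1..<k}\<close>; \<open>knot k t\<close> adds the end points \<open>t\<^sub>0 = 0\<close> and \<open>t\<^sub>k = 1\<close>.
\<close>

definition knot :: "nat \<Rightarrow> (nat \<Rightarrow> real) \<Rightarrow> nat \<Rightarrow> real" where
  "knot k t j = (if j = 0 then 0 else if j < k then t j else 1)"

definition change_points :: "nat \<Rightarrow> (nat \<Rightarrow> real) set" where
  "change_points k =
     {t \<in> {1..<k} \<rightarrow>\<^sub>E UNIV. \<forall>j\<in>{1..k}. knot k t (j - 1) < knot k t j}"

definition heights :: "real \<Rightarrow> nat \<Rightarrow> (nat \<Rightarrow> real) set" where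
  "heights K k = {1..k} \<rightarrow>\<^sub>E {-K..K}"

definition Theta_k :: "real \<Rightarrow> nat \<Rightarrow> ((nat \<Rightarrow> real) \<times> (nat \<Rightarrow> real)) set" where
  "Theta_k K k = heights K k \<times> change_points k"

text \<open>
  A model element is a triple \<open>(k, a, t)\<close>, so that \<open>Theta\<close> is the disjoint union of the
  \<open>Theta_k\<close>; \<open>step\<close> performs the identification with a step function.
\<close>

type_synonym param = "nat \<times> (nat \<Rightarrow> real) \<times> (nat \<Rightarrow> real)"

definition Theta :: "real \<Rightarrow> nat \<Rightarrow> param set" where
  "Theta K kmax = (SIGMA k:{1..kmax}. Theta_k K k)"

definition step :: "param \<Rightarrow> real \<Rightarrow> real" where
  "step = (\<lambda>(k, a, t) x. \<Sum>j=1..k. a j * indicator {knot k t (j - 1)..<knot k t j} x)"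

definition L2_norm :: "(real \<Rightarrow> real) \<Rightarrow> real" where
  "L2_norm f = sqrt (LINT x:{0..<1}|lborel. (f x)\<^sup>2)"

definition obs_law :: "(real \<Rightarrow> real) \<Rightarrow> (real \<times> real) measure" where
  "obs_law f =
     distr (uniform_measure lborel {0..<1} \<Otimes>\<^sub>M density lborel std_normal_density)
       (borel \<Otimes>\<^sub>M borel) (\<lambda>(x, e). (x, f x + e))"

definition obs_density :: "(real \<Rightarrow> real) \<Rightarrow> real \<times> real \<Rightarrow> real" where
  "obs_density f = (\<lambda>(x, y). indicator {0..<1} x * normal_density (f x) 1 y)"

definition data_law :: "(real \<Rightarrow> real) \<Rightarrow> nat \<Rightarrow> (nat \<Rightarrow> real \<times> real) measure" where
  "data_law f n = Pi\<^sub>M {1..n} (\<lambda>_. obs_law f)"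

definition heights_lebesgue :: "nat \<Rightarrow> (nat \<Rightarrow> real) measure" where
  "heights_lebesgue k = Pi\<^sub>M {1..k} (\<lambda>_. lborel)"

text \<open>For \<open>k = 1\<close> the following is the point mass on \<open>\<real>\<^sup>0\<close>.\<close>

definition points_lebesgue :: "nat \<Rightarrow> (nat \<Rightarrow> real) measure" where
  "points_lebesgue k = Pi\<^sub>M {1..<k} (\<lambda>_. lborel)"

text \<open>
  \<open>\<pi>a k a t\<close> stands for the conditional density \<open>\<pi>\<^sub>k\<^sup>a(a | t)\<close> and \<open>\<pi>t k t\<close> for the marginal
  density \<open>\<pi>\<^sub>k\<^sup>t(t)\<close>; only their values on \<open>Theta_k K k\<close> and \<open>change_points k\<close> matter.
\<close>

definition prior_densities ::
  "real \<Rightarrow> nat \<Rightarrow> (nat \<Rightarrow> (nat \<Rightarrow> real) \<Rightarrow> (nat \<Rightarrow> real) \<Rightarrow> real)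
    \<Rightarrow> (nat \<Rightarrow> (nat \<Rightarrow> real) \<Rightarrow> real) \<Rightarrow> bool" where
  "prior_densities K kmax \<pi>a \<pi>t \<longleftrightarrow> (\<forall>k\<in>{1..kmax}.
     (\<lambda>(a, t). \<pi>a k a t) \<in> borel_measurable
        (restrict_space (heights_lebesgue k \<Otimes>\<^sub>M points_lebesgue k) (Theta_k K k)) \<and>
     \<pi>t k \<in> borel_measurable (restrict_space (points_lebesgue k) (change_points k)) \<and>
     (\<forall>t\<in>change_points k. \<forall>a\<in>heights K k. 0 \<le> \<pi>a k a t) \<and>
     (\<forall>t\<in>change_points k. 0 \<le> \<pi>t k t) \<and>
     (\<forall>t\<in>change_points k. (\<integral>\<^sup>+a\<in>heights K k. ennreal (\<pi>a k a t) \<partial>heights_lebesgue k) = 1) \<and>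
     (\<integral>\<^sup>+t\<in>change_points k. ennreal (\<pi>t k t) \<partial>points_lebesgue k) = 1)"

definition bounded_away_from_0_inf :: "'a set \<Rightarrow> ('a \<Rightarrow> real) \<Rightarrow> bool" where
  "bounded_away_from_0_inf S f \<longleftrightarrow> (\<exists>c>0. \<exists>C. \<forall>x\<in>S. c \<le> f x \<and> f x \<le> C)"

definition assumption_A ::
  "real \<Rightarrow> nat \<Rightarrow> (nat \<Rightarrow> (nat \<Rightarrow> real) \<Rightarrow> (nat \<Rightarrow> real) \<Rightarrow> real)
    \<Rightarrow> (nat \<Rightarrow> (nat \<Rightarrow> real) \<Rightarrow> real) \<Rightarrow> bool" where
  "assumption_A K kmax \<pi>a \<pi>t \<longleftrightarrow> (\<forall>k\<in>{1..kmax}.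
     bounded_away_from_0_inf (Theta_k K k) (\<lambda>(a, t). \<pi>a k a t) \<and>
     bounded_away_from_0_inf (change_points k) (\<pi>t k))"

definition prior_k ::
  "real \<Rightarrow> (nat \<Rightarrow> (nat \<Rightarrow> real) \<Rightarrow> (nat \<Rightarrow> real) \<Rightarrow> real)
    \<Rightarrow> (nat \<Rightarrow> (nat \<Rightarrow> real) \<Rightarrow> real) \<Rightarrow> nat
    \<Rightarrow> ((nat \<Rightarrow> real) \<times> (nat \<Rightarrow> real)) measure" where
  "prior_k K \<pi>a \<pi>t k =
     density (restrict_space (heights_lebesgue k \<Otimes>\<^sub>M points_lebesgue k) (Theta_k K k))
       (\<lambda>(a, t). ennreal (\<pi>a k a t * \<pi>t k t))"

text \<open>
  The mixture \<open>\<Sum>\<^sub>k p(k) \<Pi>\<^sub>k\<close> on \<open>Theta\<close>; a set is measurable when its intersection with each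
  \<open>Theta_k\<close> is. Lemmas \<open>sets_prior\<close> and \<open>emeasure_prior\<close> show that \<open>measure_of\<close>
  returns exactly these sets and values.
\<close>

definition prior ::
  "real \<Rightarrow> nat \<Rightarrow> (nat \<Rightarrow> real) \<Rightarrow> (nat \<Rightarrow> (nat \<Rightarrow> real) \<Rightarrow> (nat \<Rightarrow> real) \<Rightarrow> real)
    \<Rightarrow> (nat \<Rightarrow> (nat \<Rightarrow> real) \<Rightarrow> real) \<Rightarrow> param measure" where
  "prior K kmax p \<pi>a \<pi>t = measure_of (Theta K kmax)
     {A \<in> Pow (Theta K kmax). \<forall>k\<in>{1..kmax}. Pair k -` A \<in> sets (prior_k K \<pi>a \<pi>t k)}
     (\<lambda>A. \<Sum>k=1..kmax. ennreal (p k) * emeasure (prior_k K \<pi>a \<pi>t k) (Pair k -` A))"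

definition likelihood :: "nat \<Rightarrow> (nat \<Rightarrow> real \<times> real) \<Rightarrow> param \<Rightarrow> real" where
  "likelihood n z \<theta> = (\<Prod>i=1..n. obs_density (step \<theta>) (z i))"

definition posterior ::
  "param measure \<Rightarrow> nat \<Rightarrow> (nat \<Rightarrow> real \<times> real) \<Rightarrow> param set \<Rightarrow> real" where
  "posterior Q n z A =
     (LINT \<theta>:A|Q. likelihood n z \<theta>) / (LINT \<theta>|Q. likelihood n z \<theta>)"

definition tendsto_0_in_prob :: "(nat \<Rightarrow> 'a measure) \<Rightarrow> (nat \<Rightarrow> 'a \<Rightarrow> real) \<Rightarrow> bool" where
  "tendsto_0_in_prob P f \<longleftrightarrow>
     (\<forall>\<delta>>0. (\<lambda>n. measure (P n) {z \<in> space (P n). \<bar>f n z\<bar> > \<delta>}) \<longlonglongrightarrow> 0)"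

lemma measurable_knot [measurable]:
  "(\<lambda>t. knot k t j) \<in> borel_measurable (points_lebesgue k)"
proof -
  consider "j = 0" | "j \<noteq> 0" "j < k" | "j \<noteq> 0" "\<not> j < k" by blast
  then show ?thesis
    by cases (auto simp: knot_def points_lebesgue_def)
qed

lemma sets_change_points [measurable]: "change_points k \<in> sets (points_lebesgue k)"
proof -
  have "change_points k = {t \<in> space (points_lebesgue k). \<forall>j\<in>{1..k}. knot k t (j - 1) < knot k t j}"
    by (auto simp: change_points_def points_lebesgue_def space_PiM)
  also have "\<dots> \<in> sets (points_lebesgue k)" by measurable
  finally show ?thesis .
qed

lemma sets_heights [measurable]: "heights K k \<in> sets (heights_lebesgue k)"
  unfolding heights_def heights_lebesgue_def by (intro sets_PiM_I_finite) auto

lemma sets_Theta_k [measurable]: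
  "Theta_k K k \<in> sets (heights_lebesgue k \<Otimes>\<^sub>M points_lebesgue k)"
  unfolding Theta_k_def by (intro pair_measureI) measurable

lemma space_prior_k: "space (prior_k K \<pi>a \<pi>t k) = Theta_k K k"
  using sets.sets_into_space[OF sets_Theta_k[of K k]]
  by (auto simp: prior_k_def space_restrict_space)

lemma sigma_algebra_prior:
  "sigma_algebra (Theta K kmax)
     {A \<in> Pow (Theta K kmax). \<forall>k\<in>{1..kmax}. Pair k -` A \<in> sets (prior_k K \<pi>a \<pi>t k)}"
  unfolding sigma_algebra_iff2
proof (intro conjI ballI allI impI)
  fix A assume A: "A \<in> {A \<in> Pow (Theta K kmax). \<forall>k\<in>{1..kmax}. Pair k -` A \<in> sets (prior_k K \<pi>a \<pi>t k)}"
  have "Pair k -` (Theta K kmax - A) \<in> sets (prior_k K \<pi>a \<pi>t k)" if k: "k \<in> {1..kmax}" for k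
  proof -
    have "Pair k -` (Theta K kmax - A) = space (prior_k K \<pi>a \<pi>t k) - Pair k -` A"
      using k by (auto simp: Theta_def space_prior_k)
    then show ?thesis using A k by auto
  qed
  then show "Theta K kmax - A \<in> {A \<in> Pow (Theta K kmax). \<forall>k\<in>{1..kmax}. Pair k -` A \<in> sets (prior_k K \<pi>a \<pi>t k)}"
    by auto
next
  fix A :: "nat \<Rightarrow> param set"
  assume "range A \<subseteq> {A \<in> Pow (Theta K kmax). \<forall>k\<in>{1..kmax}. Pair k -` A \<in> sets (prior_k K \<pi>a \<pi>t k)}"
  then show "(\<Union>i. A i) \<in> {A \<in> Pow (Theta K kmax). \<forall>k\<in>{1..kmax}. Pair k -` A \<in> sets (prior_k K \<pi>a \<pi>t k)}"
    by (fastforce simp: vimage_UN image_subset_iff)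
qed auto

lemma space_prior: "space (prior K kmax p \<pi>a \<pi>t) = Theta K kmax"
  unfolding prior_def by (rule space_measure_of) auto

lemma sets_prior:
  "sets (prior K kmax p \<pi>a \<pi>t) =
     {A \<in> Pow (Theta K kmax). \<forall>k\<in>{1..kmax}. Pair k -` A \<in> sets (prior_k K \<pi>a \<pi>t k)}"
  unfolding prior_def
  by (subst sets_measure_of) (blast, rule sigma_algebra.sigma_sets_eq[OF sigma_algebra_prior])

lemma emeasure_prior:
  assumes A: "A \<in> sets (prior K kmax p \<pi>a \<pi>t)"
  shows "emeasure (prior K kmax p \<pi>a \<pi>t) A =
     (\<Sum>k=1..kmax. ennreal (p k) * emeasure (prior_k K \<pi>a \<pi>t k) (Pair k -` A))"
proof (rule emeasure_measure_of[OF prior_def])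
  show "countably_additive (sets (prior K kmax p \<pi>a \<pi>t))
     (\<lambda>A. \<Sum>k=1..kmax. ennreal (p k) * emeasure (prior_k K \<pi>a \<pi>t k) (Pair k -` A))"
  proof (rule countably_additiveI)
    fix B :: "nat \<Rightarrow> param set"
    assume B: "range B \<subseteq> sets (prior K kmax p \<pi>a \<pi>t)" "disjoint_family B"
    have "(\<Sum>i. emeasure (prior_k K \<pi>a \<pi>t k) (Pair k -` B i)) =
        emeasure (prior_k K \<pi>a \<pi>t k) (Pair k -` (\<Union>i. B i))" if k: "k \<in> {1..kmax}" for k
    proof -
      have "disjoint_family (\<lambda>i. Pair k -` B i)"
        using B(2) unfolding disjoint_family_on_def by blast
      then show ?thesis
        unfolding vimage_UN using B(1) k by (intro suminf_emeasure) (auto simp: sets_prior)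
    qed
    then show "(\<Sum>i. \<Sum>k=1..kmax. ennreal (p k) * emeasure (prior_k K \<pi>a \<pi>t k) (Pair k -` B i)) =
        (\<Sum>k=1..kmax. ennreal (p k) * emeasure (prior_k K \<pi>a \<pi>t k) (Pair k -` (\<Union>i. B i)))"
      by (subst suminf_sum) (auto simp del: vimage_Union vimage_UN)
  qed
qed (use A in \<open>auto simp: positive_def\<close>)

lemma prob_space_prior_k:
  assumes "prior_densities K kmax \<pi>a \<pi>t" and k: "k \<in> {1..kmax}"
  shows "prob_space (prior_k K \<pi>a \<pi>t k)"
proof
  interpret A: product_sigma_finite "\<lambda>_::nat. lborel :: real measure" ..
  interpret H: sigma_finite_measure "heights_lebesgue k"
    unfolding heights_lebesgue_def by (rule A.sigma_finite) simp
  interpret T: sigma_finite_measure "points_lebesgue k"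
    unfolding points_lebesgue_def by (rule A.sigma_finite) simp
  interpret HT: pair_sigma_finite "heights_lebesgue k" "points_lebesgue k" ..
  let ?M = "heights_lebesgue k \<Otimes>\<^sub>M points_lebesgue k"
  let ?g = "\<lambda>(a, t). ennreal (\<pi>a k a t * \<pi>t k t)"
  have d: "(\<lambda>(a, t). \<pi>a k a t) \<in> borel_measurable (restrict_space ?M (Theta_k K k))"
    "\<pi>t k \<in> borel_measurable (restrict_space (points_lebesgue k) (change_points k))"
    "\<And>t a. t \<in> change_points k \<Longrightarrow> a \<in> heights K k \<Longrightarrow> 0 \<le> \<pi>a k a t"
    "\<And>t. t \<in> change_points k \<Longrightarrow> 0 \<le> \<pi>t k t"
    "\<And>t. t \<in> change_points k \<Longrightarrow> (\<integral>\<^sup>+a\<in>heights K k. ennreal (\<pi>a k a t) \<partial>heights_lebesgue k) = 1"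
    "(\<integral>\<^sup>+t\<in>change_points k. ennreal (\<pi>t k t) \<partial>points_lebesgue k) = 1"
    using assms unfolding prior_densities_def by blast+
  have snd: "snd \<in> measurable (restrict_space ?M (Theta_k K k))
      (restrict_space (points_lebesgue k) (change_points k))"
    by (intro measurable_restrict_space3) (auto simp: Theta_k_def)
  have "(\<lambda>z. (case z of (a, t) \<Rightarrow> \<pi>a k a t) * \<pi>t k (snd z))
      \<in> borel_measurable (restrict_space ?M (Theta_k K k))"
    by (intro borel_measurable_times d(1) measurable_compose[OF snd d(2)])
  then have "(\<lambda>z. ennreal ((case z of (a, t) \<Rightarrow> \<pi>a k a t) * \<pi>t k (snd z)))
      \<in> borel_measurable (restrict_space ?M (Theta_k K k))"
    by simp
  then have g: "?g \<in> borel_measurable (restrict_space ?M (Theta_k K k))"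
    by (simp add: case_prod_beta)
  then have g': "(\<lambda>z. ?g z * indicator (Theta_k K k) z) \<in> borel_measurable ?M"
    by (subst (asm) borel_measurable_restrict_space_iff_ennreal) auto
  have inner: "(\<integral>\<^sup>+a. ?g (a, t) * indicator (Theta_k K k) (a, t) \<partial>heights_lebesgue k) =
      ennreal (\<pi>t k t) * indicator (change_points k) t" if "t \<in> space (points_lebesgue k)" for t
  proof (cases "t \<in> change_points k")
    case t: True
    have "(\<lambda>a. (a, t)) \<in> measurable (restrict_space (heights_lebesgue k) (heights K k))
        (restrict_space ?M (Theta_k K k))"
      using t that by (intro measurable_restrict_space3) (auto simp: Theta_k_def)
    from measurable_compose[OF this d(1)]
    have "(\<lambda>a. ennreal (\<pi>a k a t)) \<in> borel_measurable (restrict_space (heights_lebesgue k) (heights K k))"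
      by simp
    then have m: "(\<lambda>a. ennreal (\<pi>a k a t) * indicator (heights K k) a) \<in> borel_measurable (heights_lebesgue k)"
      by (subst (asm) borel_measurable_restrict_space_iff_ennreal) auto
    have "(\<integral>\<^sup>+a. ?g (a, t) * indicator (Theta_k K k) (a, t) \<partial>heights_lebesgue k) =
        (\<integral>\<^sup>+a. ennreal (\<pi>t k t) * (ennreal (\<pi>a k a t) * indicator (heights K k) a) \<partial>heights_lebesgue k)"
      using t d(3,4) by (intro nn_integral_cong)
        (auto simp: Theta_k_def ennreal_mult mult.commute split: split_indicator)
    also have "\<dots> = ennreal (\<pi>t k t)"
      using t d(5) m by (simp add: nn_integral_cmult)
    finally show ?thesis using t by simp
  qed (simp add: Theta_k_def indicator_def)
  have "emeasure (prior_k K \<pi>a \<pi>t k) (space (prior_k K \<pi>a \<pi>t k)) =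
      (\<integral>\<^sup>+z. ?g z * indicator (Theta_k K k) z \<partial>?M)"
  proof -
    have "emeasure (prior_k K \<pi>a \<pi>t k) (space (prior_k K \<pi>a \<pi>t k)) =
        (\<integral>\<^sup>+z. ?g z \<partial>restrict_space ?M (Theta_k K k))"
      unfolding prior_k_def using g
      by (subst emeasure_density)
        (auto intro!: nn_integral_cong simp: sets_restrict_space_iff space_restrict_space)
    then show ?thesis by (simp add: nn_integral_restrict_space)
  qed
  also have "\<dots> = (\<integral>\<^sup>+t. \<integral>\<^sup>+a. ?g (a, t) * indicator (Theta_k K k) (a, t)
      \<partial>heights_lebesgue k \<partial>points_lebesgue k)"
    using HT.nn_integral_snd[OF g'] by simp
  also have "\<dots> = 1"
    using d(6) by (subst nn_integral_cong[OF inner]) auto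
  finally show "emeasure (prior_k K \<pi>a \<pi>t k) (space (prior_k K \<pi>a \<pi>t k)) = 1" .
qed

lemma prob_space_prior:
  assumes d: "prior_densities K kmax \<pi>a \<pi>t"
    and p: "\<forall>k\<in>{1..kmax}. p k > 0" "(\<Sum>k=1..kmax. p k) = 1"
  shows "prob_space (prior K kmax p \<pi>a \<pi>t)"
proof
  have "emeasure (prior_k K \<pi>a \<pi>t k) (Pair k -` Theta K kmax) = 1" if "k \<in> {1..kmax}" for k
  proof -
    have "Pair k -` Theta K kmax = space (prior_k K \<pi>a \<pi>t k)"
      using that by (auto simp: Theta_def space_prior_k)
    then show ?thesis using prob_space.emeasure_space_1[OF prob_space_prior_k[OF d that]] by simp
  qed
  moreover have "(\<Sum>k=1..kmax. ennreal (p k)) = 1"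
    using p by (subst sum_ennreal) (auto intro: less_imp_le)
  ultimately show "emeasure (prior K kmax p \<pi>a \<pi>t) (space (prior K kmax p \<pi>a \<pi>t)) = 1"
    by (subst emeasure_prior[OF sets.top]) (simp add: space_prior)
qed

lemma obs_law_eq_density:
  assumes f [measurable]: "f \<in> borel_measurable borel"
  shows "obs_law f = density (lborel \<Otimes>\<^sub>M lborel) (\<lambda>z. ennreal (obs_density f z))"
proof (rule measure_eqI)
  interpret U: prob_space "uniform_measure lborel {0..<1::real}"
    by (rule prob_space_uniform_measure) auto
  interpret N: prob_space "density lborel std_normal_density"
    by (rule prob_space_normal_density) simp
  interpret P: pair_sigma_finite lborel "lborel :: real measure" ..
  interpret UN: pair_sigma_finite "uniform_measure lborel {0..<1::real}" "density lborel std_normal_density" ..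
  show "sets (obs_law f) = sets (density (lborel \<Otimes>\<^sub>M lborel) (\<lambda>z. ennreal (obs_density f z)))"
    by (simp add: obs_law_def cong: sets_pair_measure_cong)
  fix A assume "A \<in> sets (obs_law f)"
  then have A [measurable]: "A \<in> sets (borel \<Otimes>\<^sub>M borel)" by (simp add: obs_law_def)
  have m [measurable]: "obs_density f \<in> borel_measurable (borel \<Otimes>\<^sub>M borel)"
    unfolding obs_density_def normal_density_def by measurable
  have shift: "(\<integral>\<^sup>+e. ennreal (std_normal_density e) * indicator A (x, f x + e) \<partial>lborel)
      = (\<integral>\<^sup>+y. ennreal (normal_density (f x) 1 y) * indicator A (x, y) \<partial>lborel)" for x
    by (subst (2) nn_integral_real_affine[where c = 1 and t = "f x"])
      (auto simp: normal_density_def)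
  have [measurable]: "(\<lambda>x. \<integral>\<^sup>+y. ennreal (normal_density (f x) 1 y) * indicator A (x, y) \<partial>lborel)
      \<in> borel_measurable borel"
    unfolding normal_density_def by measurable
  have "emeasure (obs_law f) A = (\<integral>\<^sup>+z. indicator A z \<partial>obs_law f)"
    by (simp add: obs_law_def)
  also have "\<dots> = (\<integral>\<^sup>+z. indicator A (case z of (x, e) \<Rightarrow> (x, f x + e))
       \<partial>(uniform_measure lborel {0..<1} \<Otimes>\<^sub>M density lborel std_normal_density))"
    unfolding obs_law_def by (rule nn_integral_distr) measurable
  also have "\<dots> = (\<integral>\<^sup>+x. \<integral>\<^sup>+e. indicator A (x, f x + e) \<partial>density lborel std_normal_density
       \<partial>uniform_measure lborel {0..<1})"
    by (subst N.nn_integral_fst[symmetric]) (auto intro!: nn_integral_cong)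
  also have "\<dots> = (\<integral>\<^sup>+x. (\<integral>\<^sup>+y. ennreal (normal_density (f x) 1 y) * indicator A (x, y) \<partial>lborel)
       * indicator {0..<1} x \<partial>lborel)"
    by (subst nn_integral_uniform_measure)
      (auto simp: nn_integral_density shift divide_ennreal_def intro!: nn_integral_cong)
  also have "\<dots> = (\<integral>\<^sup>+x. \<integral>\<^sup>+y. ennreal (obs_density f (x, y)) * indicator A (x, y) \<partial>lborel \<partial>lborel)"
    by (auto intro!: nn_integral_cong simp: obs_density_def split: split_indicator)
  also have "\<dots> = (\<integral>\<^sup>+z. ennreal (obs_density f z) * indicator A z \<partial>(lborel \<Otimes>\<^sub>M lborel))"
    by (subst lborel.nn_integral_fst[symmetric]) auto
  also have "\<dots> = emeasure (density (lborel \<Otimes>\<^sub>M lborel) (\<lambda>z. ennreal (obs_density f z))) A"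
    by (subst emeasure_density) auto
  finally show "emeasure (obs_law f) A =
      emeasure (density (lborel \<Otimes>\<^sub>M lborel) (\<lambda>z. ennreal (obs_density f z))) A" .
qed

end

theory Submission
  imports Defs
begin

text \<open>
  Write \<open>R \<theta>\<close> for the likelihood ratio of \<open>\<theta>\<close> against \<open>\<theta>\<^sub>0\<close>. The model has bounded functions and a
  finite net of polynomial size at \<open>L\<^sub>2\<close>-resolution \<open>1 / sqrt n\<close>. For a net point \<open>g\<close> the statistic
  \<open>sqrt (R g)\<close> has expectation at most \<open>exp (- n r \<parallel>g - \<theta>\<^sub>0\<parallel>\<^sup>2)\<close>, and so has \<open>R \<theta> / sqrt (R g)\<close> for every
  \<open>\<theta>\<close> close to \<open>g\<close> relative to \<open>\<parallel>g - \<theta>\<^sub>0\<parallel>\<close>. Let \<open>W\<close> be the sum of \<open>sqrt (R g)\<close> over the net points far from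
  \<open>\<theta>\<^sub>0\<close>; it plays the role of a test. Where \<open>W < 1\<close>, the numerator of the posterior is at most the
  integral of \<open>R \<theta> / W\<close>, whose expectation is exponentially small by Fubini. The denominator is bounded
  below without Jensen's inequality: \<open>R \<ge> 2 / T - 1 / (T\<^sup>2 R)\<close>, and \<open>1 / R\<close> has bounded expectation on the
  ball of radius \<open>1 / sqrt n\<close>, whose prior mass is at least a power of \<open>1 / n\<close>. With \<open>T = n\<close> and
  \<open>n \<epsilon>\<^sub>n\<^sup>2 = log n\<close>, the exponential bounds beat all powers of \<open>n\<close> once \<open>M\<close> is large.
\<close>

subsection \<open>Gaussian regression with uniform design\<close>

text \<open>The square of \<open>L2_norm\<close> of the difference, kept without the root because
  the exponents below are linear in it.\<close>

definition sq_dist :: "(real \<Rightarrow> real) \<Rightarrow> (real \<Rightarrow> real) \<Rightarrow> real" where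
  "sq_dist f g = (LINT x:{0..<1}|lborel. (f x - g x)\<^sup>2)"

abbreviation unif :: "real measure" where
  "unif \<equiv> uniform_measure lborel {0..<1}"

interpretation unif: prob_space unif
  by (rule prob_space_uniform_measure) auto

lemma integral_unif:
  fixes f :: "real \<Rightarrow> real"
  assumes [measurable]: "f \<in> borel_measurable borel"
  shows "(LINT x|unif. f x) = (LINT x:{0..<1}|lborel. f x)"
proof -
  have "unif = density lborel (\<lambda>x. ennreal (indicator {0..<1} x))"
    by (auto simp: uniform_measure_def divide_ennreal_def split: split_indicator intro!: density_cong)
  then show ?thesis
    by (simp add: integral_density set_lebesgue_integral_def)
qed

lemma sq_dist_unif:
  assumes [measurable]: "f \<in> borel_measurable borel" "g \<in> borel_measurable borel"
  shows "sq_dist f g = (LINT x|unif. (f x - g x)\<^sup>2)"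
  unfolding sq_dist_def by (subst integral_unif) auto

section \<open>Exponential moments of one observation\<close>

text \<open>Completing the square turns the tilted standard normal density into the normal density
  with mean \<open>a\<close>, up to the factor \<open>exp (a\<^sup>2 / 2)\<close>.\<close>

lemma nn_integral_std_normal_exp:
  "(\<integral>\<^sup>+e. ennreal (exp (a * e)) \<partial>density lborel std_normal_density) = ennreal (exp (a\<^sup>2 / 2))"
proof -
  interpret prob_space "density lborel (normal_density a 1)"
    by (rule prob_space_normal_density) simp
  have eq: "std_normal_density e * exp (a * e) = exp (a\<^sup>2 / 2) * normal_density a 1 e" for e
  proof -
    have "exp (- (e\<^sup>2) / 2) * exp (a * e) = exp (a\<^sup>2 / 2) * exp (- ((e - a)\<^sup>2) / 2)"
      unfolding exp_add[symmetric] by (simp add: power2_eq_square field_simps)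
    then show ?thesis unfolding normal_density_def by simp
  qed
  have "(\<integral>\<^sup>+e. ennreal (exp (a * e)) \<partial>density lborel std_normal_density)
      = (\<integral>\<^sup>+e. ennreal (exp (a\<^sup>2 / 2)) * ennreal (normal_density a 1 e) \<partial>lborel)"
    by (subst nn_integral_density) (auto simp flip: ennreal_mult eq)
  also have "\<dots> = ennreal (exp (a\<^sup>2 / 2)) * (\<integral>\<^sup>+e. ennreal (normal_density a 1 e) \<partial>lborel)"
    by (rule nn_integral_cmult) auto
  also have "(\<integral>\<^sup>+e. ennreal (normal_density a 1 e) \<partial>lborel) = 1"
    using emeasure_space_1 by (subst (asm) emeasure_density) auto
  finally show ?thesis by simp
qed

text \<open>The residual \<open>y - f0 x\<close> is the standard normal noise, independent of
  \<open>x\<close>. Integrating it out first leaves an average over the design alone.\<close>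

lemma nn_integral_obs_law_exp:
  assumes [measurable]: "f0 \<in> borel_measurable borel" "a \<in> borel_measurable borel" "b \<in> borel_measurable borel"
  shows "(\<integral>\<^sup>+(x, y). ennreal (exp (a x * (y - f0 x) - b x)) \<partial>obs_law f0)
    = (\<integral>\<^sup>+x. ennreal (exp ((a x)\<^sup>2 / 2 - b x)) \<partial>unif)"
proof -
  interpret N: prob_space "density lborel std_normal_density"
    by (rule prob_space_normal_density) simp
  interpret UN: pair_sigma_finite unif "density lborel std_normal_density" ..
  have "(\<integral>\<^sup>+(x, y). ennreal (exp (a x * (y - f0 x) - b x)) \<partial>obs_law f0)
     = (\<integral>\<^sup>+x. \<integral>\<^sup>+e. ennreal (exp (a x * e - b x)) \<partial>density lborel std_normal_density \<partial>unif)"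
    unfolding obs_law_def
    by (subst nn_integral_distr) (auto simp: case_prod_beta N.nn_integral_fst[symmetric])
  also have "\<dots> = (\<integral>\<^sup>+x. \<integral>\<^sup>+e. ennreal (exp (- b x)) * ennreal (exp (a x * e)) \<partial>density lborel std_normal_density \<partial>unif)"
    by (simp add: exp_diff exp_minus field_simps flip: ennreal_mult)
  also have "\<dots> = (\<integral>\<^sup>+x. ennreal (exp (- b x)) * ennreal (exp ((a x)\<^sup>2 / 2)) \<partial>unif)"
    by (subst nn_integral_cmult) (auto simp: nn_integral_std_normal_exp)
  also have "\<dots> = (\<integral>\<^sup>+x. ennreal (exp ((a x)\<^sup>2 / 2 - b x)) \<partial>unif)"
    by (simp add: exp_add[symmetric] flip: ennreal_mult)
  finally show ?thesis .
qed

text \<open>Linearises the exponential on a bounded range, with separate slopes for \<open>a\<close>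
  and \<open>b\<close>, so that integration only sees their means. The two parts decouple because
  \<open>(exp b - 1) * (1 - exp (- a))\<close> is nonnegative.\<close>

lemma exp_diff_le:
  fixes a b :: real
  assumes "0 \<le> a" "a \<le> A" "0 \<le> b" "b \<le> B"
  shows "exp (b - a) \<le> 1 - a / (1 + A) + b * exp B"
proof -
  have "exp (- a) \<le> 1 / (1 + a)"
    using assms exp_ge_add_one_self[of a] by (simp add: exp_minus field_simps)
  also have "\<dots> = 1 - a / (1 + a)" using assms by (simp add: field_simps)
  also have "\<dots> \<le> 1 - a / (1 + A)" using assms by (auto intro!: divide_left_mono mult_pos_pos)
  finally have 1: "exp (- a) \<le> 1 - a / (1 + A)" .
  have "1 - b \<le> exp (- b)" using exp_ge_add_one_self[of "- b"] by simp
  then have "(1 - b) * exp b \<le> 1" by (simp add: exp_minus field_simps)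
  then have "exp b \<le> 1 + b * exp b" by (simp add: algebra_simps)
  also have "\<dots> \<le> 1 + b * exp B" using assms by (auto intro!: mult_left_mono)
  finally have 2: "exp b \<le> 1 + b * exp B" .
  have "(exp b - 1) * (1 - exp (- a)) \<ge> 0" using assms by (intro mult_nonneg_nonneg) auto
  then have "exp (b - a) \<le> exp b + exp (- a) - 1" by (simp add: exp_diff exp_minus field_simps)
  then show ?thesis using 1 2 by simp
qed

text \<open>Integrates the linear bound \<open>exp_diff_le\<close> and returns to an exponential
  through \<open>1 + u \<le> exp u\<close>. The exponential form is what survives taking
  \<open>n\<close>-th powers.\<close>

lemma nn_integral_unif_exp_le:
  assumes [measurable]: "a \<in> borel_measurable borel" "b \<in> borel_measurable borel"
    and ab: "\<And>x. 0 \<le> a x" "\<And>x. a x \<le> A" "\<And>x. 0 \<le> b x" "\<And>x. b x \<le> B"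
  shows "(\<integral>\<^sup>+x. ennreal (exp (b x - a x)) \<partial>unif)
    \<le> ennreal (exp (exp B * (LINT x|unif. b x) - (LINT x|unif. a x) / (1 + A)))"
proof -
  have int: "integrable unif a" "integrable unif b"
    using ab by (auto intro: unif.integrable_const_bound[where B = A] unif.integrable_const_bound[where B = B])
  have le: "exp (b x - a x) \<le> 1 - a x / (1 + A) + b x * exp B" for x
    using ab by (intro exp_diff_le)
  then have nn: "0 \<le> 1 - a x / (1 + A) + b x * exp B" for x
    using exp_ge_zero[of "b x - a x"] order_trans by blast
  have "(\<integral>\<^sup>+x. ennreal (exp (b x - a x)) \<partial>unif)
      \<le> (\<integral>\<^sup>+x. ennreal (1 - a x / (1 + A) + b x * exp B) \<partial>unif)"
    using le by (intro nn_integral_mono ennreal_leI)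
  also have "\<dots> = ennreal (LINT x|unif. 1 - a x / (1 + A) + b x * exp B)"
    using nn int by (intro nn_integral_eq_integral) auto
  also have "(LINT x|unif. 1 - a x / (1 + A) + b x * exp B)
      = 1 + (exp B * (LINT x|unif. b x) - (LINT x|unif. a x) / (1 + A))"
    using int by (simp add: unif.prob_space)
  also have "ennreal \<dots> \<le> ennreal (exp (exp B * (LINT x|unif. b x) - (LINT x|unif. a x) / (1 + A)))"
    by (intro ennreal_leI exp_ge_add_one_self)
  finally show ?thesis .
qed

lemma sq_dist_nonneg: "0 \<le> sq_dist f g"
  unfolding sq_dist_def set_lebesgue_integral_def by (intro integral_nonneg_AE) auto

lemma sets_obs_law [measurable_cong]: "sets (obs_law f) = sets (borel \<Otimes>\<^sub>M borel)"
  by (simp add: obs_law_def)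

lemma prob_space_obs_law:
  assumes [measurable]: "f \<in> borel_measurable borel"
  shows "prob_space (obs_law f)"
proof -
  interpret N: prob_space "density lborel std_normal_density"
    by (rule prob_space_normal_density) simp
  interpret UN: pair_prob_space unif "density lborel std_normal_density" ..
  show ?thesis
    unfolding obs_law_def by (intro UN.prob_space_distr) measurable
qed

section \<open>Exponential statistics of the sample and likelihood ratios\<close>

text \<open>Likelihood ratios, their reciprocals and their quotients by square roots all have this
  form with different \<open>a\<close> and \<open>b\<close>, so a single expectation formula serves
  them all.\<close>

definition exp_stat ::
  "(real \<Rightarrow> real) \<Rightarrow> (real \<Rightarrow> real) \<Rightarrow> (real \<Rightarrow> real) \<Rightarrow> nat \<Rightarrow> (nat \<Rightarrow> real \<times> real) \<Rightarrow> real" where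
  "exp_stat f0 a b n z =
     exp (\<Sum>i=1..n. a (fst (z i)) * (snd (z i) - f0 (fst (z i))) - b (fst (z i)))"

lemma exp_stat_pos: "0 < exp_stat f0 a b n z"
  by (simp add: exp_stat_def)

lemma measurable_exp_stat [measurable]:
  assumes [measurable]: "f0 \<in> borel_measurable borel" "a \<in> borel_measurable borel" "b \<in> borel_measurable borel"
  shows "exp_stat f0 a b n \<in> borel_measurable (data_law f0 n)"
  unfolding exp_stat_def data_law_def by measurable

lemma nn_integral_exp_stat:
  assumes [measurable]: "f0 \<in> borel_measurable borel" "a \<in> borel_measurable borel" "b \<in> borel_measurable borel"
  shows "(\<integral>\<^sup>+z. ennreal (exp_stat f0 a b n z) \<partial>data_law f0 n)
    = (\<integral>\<^sup>+x. ennreal (exp ((a x)\<^sup>2 / 2 - b x)) \<partial>unif) ^ n"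
proof -
  interpret O: prob_space "obs_law f0" by (rule prob_space_obs_law) measurable
  interpret product_sigma_finite "\<lambda>_::nat. obs_law f0" ..
  have "(\<integral>\<^sup>+z. ennreal (exp_stat f0 a b n z) \<partial>data_law f0 n)
      = (\<integral>\<^sup>+z. (\<Prod>i=1..n. case z i of (x, y) \<Rightarrow> ennreal (exp (a x * (y - f0 x) - b x))) \<partial>data_law f0 n)"
    by (simp add: exp_stat_def exp_sum prod_ennreal case_prod_beta)
  also have "\<dots> = (\<Prod>i=1..n. \<integral>\<^sup>+(x, y). ennreal (exp (a x * (y - f0 x) - b x)) \<partial>obs_law f0)"
    unfolding data_law_def by (rule product_nn_integral_prod) auto
  also have "\<dots> = (\<integral>\<^sup>+x. ennreal (exp ((a x)\<^sup>2 / 2 - b x)) \<partial>unif) ^ n"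
    by (simp add: nn_integral_obs_law_exp)
  finally show ?thesis .
qed

text \<open>The quotient of the normal densities with means \<open>f x\<close> and
  \<open>f0 x\<close>, multiplied over the sample. The design density cancels.\<close>

definition lik_ratio :: "(real \<Rightarrow> real) \<Rightarrow> (real \<Rightarrow> real) \<Rightarrow> nat \<Rightarrow> (nat \<Rightarrow> real \<times> real) \<Rightarrow> real" where
  "lik_ratio f0 f = exp_stat f0 (\<lambda>x. f x - f0 x) (\<lambda>x. (f x - f0 x)\<^sup>2 / 2)"

lemma lik_ratio_pos: "0 < lik_ratio f0 f n z"
  by (simp add: lik_ratio_def exp_stat_pos)

text \<open>
  The exponential rate, and the relative squared distance up to which a density ratio can be
  controlled by the test statistic of a nearby point, for functions bounded by \<open>L\<close>.
\<close>

definition affinity_rate :: "real \<Rightarrow> real" where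
  "affinity_rate L = 1 / (32 + 8 * L\<^sup>2)"

definition affinity_radius :: "real \<Rightarrow> real" where
  "affinity_radius L = affinity_rate L * exp (- (4 * L\<^sup>2))"

lemma affinity_rate_pos: "0 < affinity_rate L"
  unfolding affinity_rate_def by (intro divide_pos_pos add_pos_nonneg) auto

lemma affinity_radius_pos: "0 < affinity_radius L"
  unfolding affinity_radius_def by (simp add: affinity_rate_pos)

lemma sq_diff_le:
  fixes u v L :: real
  assumes "\<bar>u\<bar> \<le> L" "\<bar>v\<bar> \<le> L"
  shows "(u - v)\<^sup>2 \<le> 4 * L\<^sup>2"
proof -
  have "\<bar>u - v\<bar> \<le> 2 * L" using assms by linarith
  then have "\<bar>u - v\<bar>\<^sup>2 \<le> (2 * L)\<^sup>2" by (intro power_mono) auto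
  then show ?thesis by (simp add: power2_eq_square)
qed

text \<open>For \<open>f = g\<close> this bounds the Hellinger affinity between \<open>g\<close> and
  \<open>f0\<close>. Replacing the numerator by a nearby \<open>f\<close> adds a multiple of
  \<open>sq_dist f g\<close> to the exponent, and \<open>close\<close> keeps this below half of the
  available decay.\<close>

lemma nn_integral_lik_ratio_div_sqrt:
  assumes [measurable]: "f0 \<in> borel_measurable borel" "f \<in> borel_measurable borel" "g \<in> borel_measurable borel"
    and bd: "\<And>x. \<bar>f0 x\<bar> \<le> L" "\<And>x. \<bar>f x\<bar> \<le> L" "\<And>x. \<bar>g x\<bar> \<le> L"
    and close: "sq_dist f g \<le> affinity_radius L * sq_dist g f0"
  shows "(\<integral>\<^sup>+z. ennreal (lik_ratio f0 f n z / sqrt (lik_ratio f0 g n z)) \<partial>data_law f0 n)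
    \<le> ennreal (exp (- (real n * affinity_rate L * sq_dist g f0)))"
proof -
  let ?d = "\<lambda>x. f x - f0 x" and ?h = "\<lambda>x. g x - f0 x" and ?u = "\<lambda>x. f x - g x"
  have sqrt_exp: "sqrt (exp w) = exp (w / 2)" for w :: real
    by (rule real_sqrt_unique) (simp_all add: power2_eq_square exp_add[symmetric])
  have "lik_ratio f0 f n z / sqrt (lik_ratio f0 g n z)
      = exp_stat f0 (\<lambda>x. ?d x - ?h x / 2) (\<lambda>x. (?d x)\<^sup>2 / 2 - (?h x)\<^sup>2 / 4) n z" for z
    unfolding lik_ratio_def exp_stat_def sqrt_exp exp_diff[symmetric] sum_divide_distrib sum_subtractf[symmetric]
    by (intro sum.cong refl arg_cong[where f = exp]) (simp add: field_simps)
  then have "(\<integral>\<^sup>+z. ennreal (lik_ratio f0 f n z / sqrt (lik_ratio f0 g n z)) \<partial>data_law f0 n)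
      = (\<integral>\<^sup>+x. ennreal (exp ((?d x - ?h x / 2)\<^sup>2 / 2 - ((?d x)\<^sup>2 / 2 - (?h x)\<^sup>2 / 4))) \<partial>unif) ^ n"
    by (simp add: nn_integral_exp_stat)
  also have "\<dots> \<le> (\<integral>\<^sup>+x. ennreal (exp ((?u x)\<^sup>2 - (?h x)\<^sup>2 / 16)) \<partial>unif) ^ n"
  proof (intro power_mono nn_integral_mono ennreal_leI, subst exp_le_cancel_iff)
    fix x
    \<comment> \<open>Since \<open>?d = ?h + ?u\<close>, the exponent on the left equals
      \<open>- (?h x)\<^sup>2 / 8 - ?h x * ?u x / 2\<close>. This square absorbs the mixed term at
      the cost of half of the decay.\<close>
    have "0 \<le> (?h x / 4 + ?u x)\<^sup>2" by simp
    then show "(?d x - ?h x / 2)\<^sup>2 / 2 - ((?d x)\<^sup>2 / 2 - (?h x)\<^sup>2 / 4) \<le> (?u x)\<^sup>2 - (?h x)\<^sup>2 / 16"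
      by (simp add: power2_eq_square field_simps)
  qed auto
  also have "\<dots> \<le> ennreal (exp (exp (4 * L\<^sup>2) * (LINT x|unif. (?u x)\<^sup>2)
      - (LINT x|unif. (?h x)\<^sup>2 / 16) / (1 + L\<^sup>2 / 4))) ^ n"
    using sq_diff_le[OF bd(3) bd(1)] sq_diff_le[OF bd(2) bd(3)]
    by (intro power_mono nn_integral_unif_exp_le) (auto simp: mult.commute)
  also have "exp (4 * L\<^sup>2) * (LINT x|unif. (?u x)\<^sup>2) - (LINT x|unif. (?h x)\<^sup>2 / 16) / (1 + L\<^sup>2 / 4)
      = exp (4 * L\<^sup>2) * sq_dist f g - 2 * affinity_rate L * sq_dist g f0"
  proof -
    have "32 + 8 * L\<^sup>2 = 2 * (16 * (1 + L\<^sup>2 / 4))" by simp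
    then have "2 * affinity_rate L = 1 / (16 * (1 + L\<^sup>2 / 4))"
      unfolding affinity_rate_def by (metis divide_divide_eq_left nonzero_mult_div_cancel_left times_divide_eq_right zero_neq_numeral mult.right_neutral)
    then show ?thesis by (simp add: sq_dist_unif)
  qed
  also have "ennreal (exp \<dots>) ^ n \<le> ennreal (exp (- (affinity_rate L * sq_dist g f0))) ^ n"
  proof (intro power_mono ennreal_leI, subst exp_le_cancel_iff)
    \<comment> \<open>\<open>affinity_radius\<close> is chosen so that its factor cancels
      \<open>exp (4 * L\<^sup>2)\<close>. The error term then uses up one of the two available
      multiples of \<open>affinity_rate L\<close>.\<close>
    have "exp (4 * L\<^sup>2) * sq_dist f g \<le> exp (4 * L\<^sup>2) * (affinity_radius L * sq_dist g f0)"
      using close by (intro mult_left_mono) auto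
    also have "\<dots> = affinity_rate L * sq_dist g f0"
      by (simp add: affinity_radius_def exp_minus)
    finally show "exp (4 * L\<^sup>2) * sq_dist f g - 2 * affinity_rate L * sq_dist g f0
        \<le> - (affinity_rate L * sq_dist g f0)" by simp
  qed auto
  also have "\<dots> = ennreal (exp (- (real n * affinity_rate L * sq_dist g f0)))"
    by (simp add: ennreal_power exp_of_nat_mult[symmetric] mult.assoc)
  finally show ?thesis .
qed

text \<open>The case \<open>f = g\<close> of the preceding bound, since a ratio divided by its
  square root is the square root.\<close>

lemma nn_integral_sqrt_lik_ratio:
  assumes [measurable]: "f0 \<in> borel_measurable borel" "g \<in> borel_measurable borel"
    and bd: "\<And>x. \<bar>f0 x\<bar> \<le> L" "\<And>x. \<bar>g x\<bar> \<le> L"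
  shows "(\<integral>\<^sup>+z. ennreal (sqrt (lik_ratio f0 g n z)) \<partial>data_law f0 n)
    \<le> ennreal (exp (- (real n * affinity_rate L * sq_dist g f0)))"
proof -
  have "sq_dist g g \<le> affinity_radius L * sq_dist g f0"
    using sq_dist_nonneg[of g f0] affinity_radius_pos[of L]
    by (simp add: sq_dist_def[of g g])
  from nn_integral_lik_ratio_div_sqrt[OF assms(1,2,2) bd(1,2,2) this, of n]
  show ?thesis
    by (simp add: real_div_sqrt less_imp_le[OF lik_ratio_pos])
qed

text \<open>Tilting by \<open>f0 - f\<close> makes the expectation per observation the design
  average of \<open>exp ((f x - f0 x)\<^sup>2)\<close>. It stays bounded in \<open>n\<close> when
  \<open>sq_dist f f0\<close> is of order \<open>1 / n\<close>, which serves the denominator of the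
  posterior.\<close>

lemma nn_integral_inverse_lik_ratio:
  assumes [measurable]: "f0 \<in> borel_measurable borel" "f \<in> borel_measurable borel"
    and bd: "\<And>x. \<bar>f0 x\<bar> \<le> L" "\<And>x. \<bar>f x\<bar> \<le> L"
  shows "(\<integral>\<^sup>+z. ennreal (1 / lik_ratio f0 f n z) \<partial>data_law f0 n)
    \<le> ennreal (exp (exp (4 * L\<^sup>2) * (real n * sq_dist f f0)))"
proof -
  let ?d = "\<lambda>x. f x - f0 x"
  have "1 / lik_ratio f0 f n z = exp_stat f0 (\<lambda>x. - ?d x) (\<lambda>x. - ((?d x)\<^sup>2 / 2)) n z" for z
    unfolding lik_ratio_def exp_stat_def inverse_eq_divide[symmetric] exp_minus[symmetric] sum_negf[symmetric]
    by (intro sum.cong refl arg_cong[where f = exp]) (simp add: field_simps)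
  then have "(\<integral>\<^sup>+z. ennreal (1 / lik_ratio f0 f n z) \<partial>data_law f0 n)
      = (\<integral>\<^sup>+x. ennreal (exp ((?d x)\<^sup>2 - 0)) \<partial>unif) ^ n"
    by (simp add: nn_integral_exp_stat power2_commute[of "f0 x" "f x" for x])
  also have "\<dots> \<le> ennreal (exp (exp (4 * L\<^sup>2) * (LINT x|unif. (?d x)\<^sup>2) - (LINT x|unif. 0) / (1 + 0))) ^ n"
    using sq_diff_le[OF bd(2) bd(1)] by (intro power_mono nn_integral_unif_exp_le) auto
  also have "\<dots> = ennreal (exp (exp (4 * L\<^sup>2) * (real n * sq_dist f f0)))"
    by (simp add: sq_dist_unif ennreal_power exp_of_nat_mult[symmetric] mult_ac)
  finally show ?thesis .
qed

subsection \<open>A tail bound for posteriors\<close>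

text \<open>The deterministic core, applied to one fixed sample. Hypothesis \<open>I\<close> forces
  the denominator to be at least \<open>measure Q B / T\<close>, and \<open>V\<close> puts the
  numerator below \<delta> times that value.\<close>

lemma set_integral_ratio_less:
  fixes r :: "'a \<Rightarrow> real"
  assumes Q: "prob_space Q" and A [measurable]: "A \<in> sets Q" "B \<in> sets Q"
    and r: "integrable Q r" "\<And>\<theta>. 0 < r \<theta>" and T: "0 < T" and pos: "0 < measure Q B"
    and I: "(\<integral>\<^sup>+\<theta>\<in>B. ennreal (1 / r \<theta>) \<partial>Q) \<le> ennreal (T * measure Q B)"
    and V: "(\<integral>\<^sup>+\<theta>\<in>A. ennreal (r \<theta>) \<partial>Q) < ennreal (\<delta> * (measure Q B / T))"
  shows "\<bar>(LINT \<theta>:A|Q. r \<theta>) / (LINT \<theta>|Q. r \<theta>)\<bar> < \<delta>"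
proof -
  interpret prob_space Q by fact
  have rm [measurable]: "r \<in> borel_measurable Q" using r(1) by auto
  have iA: "integrable Q (\<lambda>\<theta>. indicator A \<theta> * r \<theta>)"
    and iB: "integrable Q (\<lambda>\<theta>. indicator B \<theta> * r \<theta>)"
    using integrable_real_mult_indicator[OF A(1) r(1)] integrable_real_mult_indicator[OF A(2) r(1)]
    by (simp_all add: mult.commute)
  have nA: "0 \<le> (LINT \<theta>|Q. indicator A \<theta> * r \<theta>)"
    using r(2) by (intro integral_nonneg_AE) (auto simp: less_imp_le)
  have "(\<integral>\<^sup>+\<theta>\<in>A. ennreal (r \<theta>) \<partial>Q) = ennreal (LINT \<theta>|Q. indicator A \<theta> * r \<theta>)"
    using r(2) by (subst nn_integral_eq_integral[OF iA, symmetric])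
      (auto intro!: nn_integral_cong simp: less_imp_le split: split_indicator)
  with V have NA: "(LINT \<theta>|Q. indicator A \<theta> * r \<theta>) < \<delta> * (measure Q B / T)"
    using nA by (simp add: ennreal_less_iff)
  have i1: "integrable Q (\<lambda>\<theta>. indicator B \<theta> * (1 / r \<theta>))"
  proof (rule integrableI_bounded)
    have "(\<integral>\<^sup>+\<theta>. ennreal (norm (indicator B \<theta> * (1 / r \<theta>))) \<partial>Q) = (\<integral>\<^sup>+\<theta>\<in>B. ennreal (1 / r \<theta>) \<partial>Q)"
      using r(2) by (intro nn_integral_cong) (auto simp: less_imp_le split: split_indicator)
    also note I
    finally show "(\<integral>\<^sup>+\<theta>. ennreal (norm (indicator B \<theta> * (1 / r \<theta>))) \<partial>Q) < \<infinity>"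
      by (rule le_less_trans) simp
  qed simp
  have "ennreal (LINT \<theta>|Q. indicator B \<theta> * (1 / r \<theta>)) = (\<integral>\<^sup>+\<theta>\<in>B. ennreal (1 / r \<theta>) \<partial>Q)"
    using r(2) by (subst nn_integral_eq_integral[OF i1, symmetric])
      (auto intro!: nn_integral_cong simp: less_imp_le split: split_indicator)
  with I have "ennreal (LINT \<theta>|Q. indicator B \<theta> * (1 / r \<theta>)) \<le> ennreal (T * measure Q B)"
    by simp
  then have IB: "(LINT \<theta>|Q. indicator B \<theta> * (1 / r \<theta>)) \<le> T * measure Q B"
    using T pos by (subst (asm) ennreal_le_iff) auto
  have le: "indicator B \<theta> * (2 / T) - indicator B \<theta> * (1 / r \<theta>) / T\<^sup>2 \<le> indicator B \<theta> * r \<theta>" for \<theta>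
  proof -
    \<comment> \<open>Expanding this square gives a lower bound for \<open>r \<theta>\<close> that
      is affine in \<open>1 / r \<theta>\<close>, so an upper bound on the integral of
      \<open>1 / r\<close> yields a lower bound on that of \<open>r\<close>.\<close>
    have "0 \<le> (r \<theta> - 1 / T)\<^sup>2 / r \<theta>" using r(2)[of \<theta>] by simp
    also have "\<dots> = r \<theta> - 2 / T + (1 / r \<theta>) / T\<^sup>2"
      using r(2)[of \<theta>] T by (simp add: power2_eq_square field_simps)
    finally show ?thesis by (simp split: split_indicator)
  qed
  have i2: "integrable Q (\<lambda>\<theta>. indicator B \<theta> * (2 / T))"
    by (rule integrable_const_bound[where B = "2 / T"]) (use T in \<open>auto split: split_indicator\<close>)
  have i3: "integrable Q (\<lambda>\<theta>. indicator B \<theta> * (1 / r \<theta>) / T\<^sup>2)"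
    using i1 by (rule integrable_divide_zero)
  have "measure Q B / T \<le> 2 / T * measure Q B - (LINT \<theta>|Q. indicator B \<theta> * (1 / r \<theta>)) / T\<^sup>2"
  proof -
    have "(LINT \<theta>|Q. indicator B \<theta> * (1 / r \<theta>)) / T\<^sup>2 \<le> T * measure Q B / T\<^sup>2"
      using IB by (intro divide_right_mono) auto
    also have "\<dots> = measure Q B / T" using T by (simp add: power2_eq_square)
    finally show ?thesis by simp
  qed
  also have "\<dots> = (LINT \<theta>|Q. indicator B \<theta> * (2 / T) - indicator B \<theta> * (1 / r \<theta>) / T\<^sup>2)"
    unfolding Bochner_Integration.integral_diff[OF i2 i3] integral_divide_zero integral_mult_left_zero
    by simp
  also have "\<dots> \<le> (LINT \<theta>|Q. indicator B \<theta> * r \<theta>)"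
    by (rule integral_mono[OF Bochner_Integration.integrable_diff[OF i2 i3] iB le])
  also have "\<dots> \<le> (LINT \<theta>|Q. r \<theta>)"
    using r(2) by (intro integral_mono iB r(1)) (auto simp: less_imp_le split: split_indicator)
  finally have D: "measure Q B / T \<le> (LINT \<theta>|Q. r \<theta>)" .
  have D0: "0 < measure Q B / T" using T pos by simp
  \<comment> \<open>The sign of \<delta> follows from \<open>V\<close>: a nonnegative numerator lies
    strictly below \<delta> times a positive number.\<close>
  have "\<delta> > 0" using zero_less_mult_pos2[OF le_less_trans[OF nA NA] D0] .
  then have "\<delta> * (measure Q B / T) \<le> \<delta> * (LINT \<theta>|Q. r \<theta>)"
    by (intro mult_left_mono D) simp
  then have "(LINT \<theta>|Q. indicator A \<theta> * r \<theta>) / (LINT \<theta>|Q. r \<theta>) < \<delta>"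
    using NA D D0 by (simp add: divide_less_eq)
  then show ?thesis
    using nA D D0 by (simp add: set_lebesgue_integral_def)
qed

section \<open>The posterior in terms of likelihood ratios\<close>

lemma prob_space_data_law:
  assumes [measurable]: "f \<in> borel_measurable borel"
  shows "prob_space (data_law f n)"
  unfolding data_law_def by (intro prob_space_PiM prob_space_obs_law) measurable

lemma normal_density_shift:
  "normal_density m 1 y = normal_density m0 1 y * exp ((m - m0) * (y - m0) - (m - m0)\<^sup>2 / 2)"
proof -
  have "exp (- (y - m)\<^sup>2 / 2) = exp (- (y - m0)\<^sup>2 / 2) * exp ((m - m0) * (y - m0) - (m - m0)\<^sup>2 / 2)"
    unfolding exp_add[symmetric] by (simp add: power2_eq_square field_simps)
  then show ?thesis by (simp add: normal_density_def)
qed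

text \<open>Stated as a product rather than a quotient, so that it also holds for samples on which
  the density under \<open>f0\<close> vanishes.\<close>

lemma likelihood_eq_lik_ratio:
  "likelihood n z \<theta> = (\<Prod>i=1..n. obs_density f0 (z i)) * lik_ratio f0 (step \<theta>) n z"
  unfolding likelihood_def lik_ratio_def exp_stat_def
  by (auto simp: obs_density_def exp_sum prod.distrib[symmetric] case_prod_beta
      normal_density_shift[of "step \<theta> x" _ "f0 x" for x] intro!: prod.cong)

lemma posterior_eq_lik_ratio:
  assumes "(\<Prod>i=1..n. obs_density f0 (z i)) \<noteq> 0"
  shows "posterior Q n z A =
    (LINT \<theta>:A|Q. lik_ratio f0 (step \<theta>) n z) / (LINT \<theta>|Q. lik_ratio f0 (step \<theta>) n z)"
  using assms unfolding posterior_def likelihood_eq_lik_ratio[where ?f0.0 = f0]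
  by simp

text \<open>Here the likelihood vanishes for every \<theta>, and \<open>0 / 0 = 0\<close>. This
  settles samples with a design point outside \<open>{0..<1}\<close> without an almost-sure
  argument.\<close>

lemma posterior_eq_0:
  assumes "(\<Prod>i=1..n. obs_density f0 (z i)) = 0"
  shows "posterior Q n z A = 0"
  using assms by (simp add: posterior_def likelihood_eq_lik_ratio[where ?f0.0 = f0])

text \<open>Dropping the negative quadratic term gives a bound depending on the sample but not on
  \<open>f\<close>. It makes the likelihood ratio integrable over the parameter for each fixed
  sample.\<close>

lemma lik_ratio_le:
  assumes bd: "\<And>x. \<bar>f0 x\<bar> \<le> L" "\<And>x. \<bar>f x\<bar> \<le> L"
  shows "lik_ratio f0 f n z \<le> exp (\<Sum>i=1..n. 2 * L * \<bar>snd (z i) - f0 (fst (z i))\<bar>)"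
  unfolding lik_ratio_def exp_stat_def
proof (subst exp_le_cancel_iff, intro sum_mono)
  fix i
  have "\<bar>f (fst (z i)) - f0 (fst (z i))\<bar> \<le> 2 * L"
    using bd[of "fst (z i)"] by linarith
  then have "\<bar>f (fst (z i)) - f0 (fst (z i))\<bar> * \<bar>snd (z i) - f0 (fst (z i))\<bar>
      \<le> 2 * L * \<bar>snd (z i) - f0 (fst (z i))\<bar>"
    by (intro mult_right_mono) auto
  then have "(f (fst (z i)) - f0 (fst (z i))) * (snd (z i) - f0 (fst (z i)))
      \<le> 2 * L * \<bar>snd (z i) - f0 (fst (z i))\<bar>"
    unfolding abs_mult[symmetric] by (rule order_trans[OF abs_ge_self])
  then show "(f (fst (z i)) - f0 (fst (z i))) * (snd (z i) - f0 (fst (z i)))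
      - (f (fst (z i)) - f0 (fst (z i)))\<^sup>2 / 2 \<le> 2 * L * \<bar>snd (z i) - f0 (fst (z i))\<bar>"
    using zero_le_power2[of "f (fst (z i)) - f0 (fst (z i))"] by linarith
qed

section \<open>Tail bound for an abstract prior on uniformly bounded step functions\<close>

context
  fixes Q :: "param measure" and f0 :: "real \<Rightarrow> real" and L :: real
  assumes Q: "prob_space Q"
    and step_m [measurable]: "(\<lambda>(\<theta>, x). step \<theta> x) \<in> borel_measurable (Q \<Otimes>\<^sub>M borel)"
    and step_le: "\<And>\<theta> x. \<theta> \<in> space Q \<Longrightarrow> \<bar>step \<theta> x\<bar> \<le> L"
    and f0_m [measurable]: "f0 \<in> borel_measurable borel"
    and f0_le: "\<And>x. \<bar>f0 x\<bar> \<le> L"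
begin

interpretation Q: prob_space Q by (rule Q)

lemma measurable_step_param:
  assumes "\<theta> \<in> space Q" shows "step \<theta> \<in> borel_measurable borel"
proof -
  have "(\<lambda>x. case (\<theta>, x) of (\<theta>, x) \<Rightarrow> step \<theta> x) \<in> borel_measurable borel"
    by (rule measurable_compose[OF _ step_m]) (use assms in measurable)
  then show ?thesis by simp
qed

text \<open>Joint measurability in sample and parameter is what lets Fubini exchange the two
  integrals below.\<close>

lemma measurable_lik_ratio_pair [measurable]:
  "(\<lambda>(z, \<theta>). lik_ratio f0 (step \<theta>) n z) \<in> borel_measurable (data_law f0 n \<Otimes>\<^sub>M Q)"
proof -
  have s [measurable]: "(\<lambda>w. step (snd w) (fst (fst w i))) \<in> borel_measurable (data_law f0 n \<Otimes>\<^sub>M Q)"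
    if "i \<in> {1..n}" for i
  proof -
    have "(\<lambda>w. (snd w, fst (fst w i))) \<in> data_law f0 n \<Otimes>\<^sub>M Q \<rightarrow>\<^sub>M Q \<Otimes>\<^sub>M borel"
      using that unfolding data_law_def by measurable
    from measurable_compose[OF this step_m] show ?thesis by simp
  qed
  have [measurable]: "(\<lambda>w. fst w i) \<in> data_law f0 n \<Otimes>\<^sub>M Q \<rightarrow>\<^sub>M borel \<Otimes>\<^sub>M borel"
    if "i \<in> {1..n}" for i
    using that unfolding data_law_def by measurable
  show ?thesis
    unfolding lik_ratio_def exp_stat_def case_prod_beta by measurable
qed

lemma integrable_lik_ratio:
  assumes "z \<in> space (data_law f0 n)"
  shows "integrable Q (\<lambda>\<theta>. lik_ratio f0 (step \<theta>) n z)"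
proof (rule Q.integrable_const_bound)
  have "(\<lambda>\<theta>. case (z, \<theta>) of (z, \<theta>) \<Rightarrow> lik_ratio f0 (step \<theta>) n z) \<in> borel_measurable Q"
    by (rule measurable_compose[OF _ measurable_lik_ratio_pair]) (use assms in measurable)
  then show "(\<lambda>\<theta>. lik_ratio f0 (step \<theta>) n z) \<in> borel_measurable Q" by simp
  show "AE \<theta> in Q. norm (lik_ratio f0 (step \<theta>) n z)
      \<le> exp (\<Sum>i=1..n. 2 * L * \<bar>snd (z i) - f0 (fst (z i))\<bar>)"
  proof (rule AE_I2)
    fix \<theta> assume "\<theta> \<in> space Q"
    from lik_ratio_le[OF f0_le step_le[OF this], where n = n and z = z]
    show "norm (lik_ratio f0 (step \<theta>) n z) \<le> exp (\<Sum>i=1..n. 2 * L * \<bar>snd (z i) - f0 (fst (z i))\<bar>)"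
      by (simp add: less_imp_le[OF lik_ratio_pos])
  qed
qed

text \<open>Outside three bad events, \<open>W \<ge> 1\<close>, \<open>I\<close> large and
  \<open>V\<close> large, \<open>set_integral_ratio_less\<close> keeps the posterior mass of
  \<open>A\<close> below \<delta>. Markov's inequality bounds each event and yields the three terms
  on the right.\<close>

lemma posterior_tail_bound:
  fixes G :: "(real \<Rightarrow> real) set" and \<rho> \<delta> T :: real
  assumes A [measurable]: "A \<in> sets Q" and B [measurable]: "B \<in> sets Q"
    and G: "finite G" "\<And>g. g \<in> G \<Longrightarrow> g \<in> borel_measurable borel" "\<And>g x. g \<in> G \<Longrightarrow> \<bar>g x\<bar> \<le> L"
    and far: "\<And>g. g \<in> G \<Longrightarrow> \<rho> \<le> sq_dist g f0"
    and net: "\<And>\<theta>. \<theta> \<in> A \<Longrightarrow> \<exists>g\<in>G. sq_dist (step \<theta>) g \<le> affinity_radius L * sq_dist g f0"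
    and near: "\<And>\<theta>. \<theta> \<in> B \<Longrightarrow> real n * sq_dist (step \<theta>) f0 \<le> 1"
    and pos: "0 < measure Q B" and T: "0 < T" and \<delta>: "0 < \<delta>"
  shows "measure (data_law f0 n) {z \<in> space (data_law f0 n). \<bar>posterior Q n z A\<bar> > \<delta>}
    \<le> exp (exp (4 * L\<^sup>2)) / T
      + (card G + T / (\<delta> * measure Q B)) * exp (- (real n * affinity_rate L * \<rho>))"
proof -
  let ?P = "data_law f0 n" and ?R = "\<lambda>f z. lik_ratio f0 f n z"
  let ?b = "exp (- (real n * affinity_rate L * \<rho>))"
  interpret P: prob_space ?P by (rule prob_space_data_law) measurable
  interpret PQ: pair_sigma_finite ?P Q ..
  define W where "W z = (\<Sum>g\<in>G. sqrt (?R g z))" for z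
  define I where "I z = (\<integral>\<^sup>+\<theta>\<in>B. ennreal (1 / ?R (step \<theta>) z) \<partial>Q)" for z
  \<comment> \<open>Where \<open>W z < 1\<close>, dividing by \<open>W z\<close> only enlarges the
    numerator. Conversely \<open>W z\<close> is at least the square root belonging to a net point
    near \<theta>, so the expectation of \<open>V\<close> falls under
    \<open>nn_integral_lik_ratio_div_sqrt\<close>.\<close>
  define V where "V z = (\<integral>\<^sup>+\<theta>\<in>A. ennreal (?R (step \<theta>) z / W z) \<partial>Q)" for z
  have Rg [measurable]: "?R g \<in> borel_measurable ?P" if "g \<in> G" for g
    using G(2)[OF that] unfolding lik_ratio_def by measurable
  have W_m [measurable]: "W \<in> borel_measurable ?P"
    unfolding W_def by measurable
  have I_m [measurable]: "I \<in> borel_measurable ?P" unfolding I_def by measurable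
  have V_m [measurable]: "V \<in> borel_measurable ?P" unfolding V_def by measurable
  have W_ge: "sqrt (?R g z) \<le> W z" if "g \<in> G" for g z
    unfolding W_def using that G(1) by (intro member_le_sum) (auto simp: less_imp_le[OF lik_ratio_pos])
  have decay: "exp (- (real n * affinity_rate L * sq_dist g f0)) \<le> ?b" if "g \<in> G" for g
    using far[OF that] affinity_rate_pos[of L] by (simp add: mult_left_mono)
  have EW: "(\<integral>\<^sup>+z. ennreal (W z) \<partial>?P) \<le> ennreal (card G * ?b)"
  proof -
    have "ennreal (W z) = (\<Sum>g\<in>G. ennreal (sqrt (?R g z)))" for z
      by (simp add: W_def less_imp_le[OF lik_ratio_pos])
    then have "(\<integral>\<^sup>+z. ennreal (W z) \<partial>?P) = (\<Sum>g\<in>G. \<integral>\<^sup>+z. ennreal (sqrt (?R g z)) \<partial>?P)"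
      by (simp add: nn_integral_sum)
    also have "\<dots> \<le> (\<Sum>g\<in>G. ennreal ?b)"
      using nn_integral_sqrt_lik_ratio[OF f0_m G(2) f0_le G(3)] decay
      by (intro sum_mono) (meson ennreal_leI order_trans)
    also have "\<dots> = ennreal (card G * ?b)" by (simp add: ennreal_mult ennreal_of_nat_eq_real_of_nat)
    finally show ?thesis .
  qed
  have EI: "(\<integral>\<^sup>+z. I z \<partial>?P) \<le> ennreal (exp (exp (4 * L\<^sup>2)) * measure Q B)"
  proof -
    have "(\<integral>\<^sup>+z. I z \<partial>?P) = (\<integral>\<^sup>+\<theta>. \<integral>\<^sup>+z. ennreal (1 / ?R (step \<theta>) z) * indicator B \<theta> \<partial>?P \<partial>Q)"
      unfolding I_def by (subst PQ.Fubini') auto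
    also have "\<dots> \<le> (\<integral>\<^sup>+\<theta>. ennreal (exp (exp (4 * L\<^sup>2))) * indicator B \<theta> \<partial>Q)"
    proof (rule nn_integral_mono)
      fix \<theta> assume \<theta>: "\<theta> \<in> space Q"
      note [measurable] = measurable_step_param[OF \<theta>]
      show "(\<integral>\<^sup>+z. ennreal (1 / ?R (step \<theta>) z) * indicator B \<theta> \<partial>?P)
          \<le> ennreal (exp (exp (4 * L\<^sup>2))) * indicator B \<theta>"
      proof (cases "\<theta> \<in> B")
        case True
        have "exp (exp (4 * L\<^sup>2) * (real n * sq_dist (step \<theta>) f0)) \<le> exp (exp (4 * L\<^sup>2))"
          using near[OF True] by (simp add: mult_left_le)
        with nn_integral_inverse_lik_ratio[OF f0_m measurable_step_param[OF \<theta>] f0_le step_le[OF \<theta>], of n]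
        show ?thesis using True by (auto intro: order_trans ennreal_leI)
      qed simp
    qed
    also have "\<dots> = ennreal (exp (exp (4 * L\<^sup>2)) * measure Q B)"
      by (simp add: nn_integral_cmult Q.emeasure_eq_measure ennreal_mult)
    finally show ?thesis .
  qed
  have EV: "(\<integral>\<^sup>+z. V z \<partial>?P) \<le> ennreal ?b"
  proof -
    have "(\<integral>\<^sup>+z. V z \<partial>?P) = (\<integral>\<^sup>+\<theta>. \<integral>\<^sup>+z. ennreal (?R (step \<theta>) z / W z) * indicator A \<theta> \<partial>?P \<partial>Q)"
      unfolding V_def by (subst PQ.Fubini') auto
    also have "\<dots> \<le> (\<integral>\<^sup>+\<theta>. ennreal ?b \<partial>Q)"
    proof (rule nn_integral_mono)
      fix \<theta> assume \<theta>: "\<theta> \<in> space Q"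
      show "(\<integral>\<^sup>+z. ennreal (?R (step \<theta>) z / W z) * indicator A \<theta> \<partial>?P) \<le> ennreal ?b"
      proof (cases "\<theta> \<in> A")
        case True
        then obtain g where g: "g \<in> G" "sq_dist (step \<theta>) g \<le> affinity_radius L * sq_dist g f0"
          using net by blast
        have "(\<integral>\<^sup>+z. ennreal (?R (step \<theta>) z / W z) * indicator A \<theta> \<partial>?P)
            \<le> (\<integral>\<^sup>+z. ennreal (?R (step \<theta>) z / sqrt (?R g z)) \<partial>?P)"
        proof (rule nn_integral_mono)
          fix z
          have s: "0 < sqrt (?R g z)" using lik_ratio_pos by simp
          have "?R (step \<theta>) z / W z \<le> ?R (step \<theta>) z / sqrt (?R g z)"
            by (rule divide_left_mono[OF W_ge[OF g(1)] less_imp_le[OF lik_ratio_pos] mult_pos_pos[OF _ s]])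
              (rule less_le_trans[OF s W_ge[OF g(1)]])
          from ennreal_leI[OF this]
          show "ennreal (?R (step \<theta>) z / W z) * indicator A \<theta> \<le> ennreal (?R (step \<theta>) z / sqrt (?R g z))"
            using True by (simp only: indicator_simps mult_1_right)
        qed
        also have "\<dots> \<le> ennreal (exp (- (real n * affinity_rate L * sq_dist g f0)))"
          by (rule nn_integral_lik_ratio_div_sqrt[OF f0_m measurable_step_param[OF \<theta>] G(2)[OF g(1)]
                f0_le step_le[OF \<theta>] G(3)[OF g(1)] g(2)])
        also have "\<dots> \<le> ennreal ?b" using decay[OF g(1)] by (rule ennreal_leI)
        finally show ?thesis .
      qed simp
    qed
    also have "\<dots> = ennreal ?b" by (simp add: Q.emeasure_space_1)
    finally show ?thesis .
  qed
  have markov: "measure ?P {z \<in> space ?P. ennreal c \<le> u z} \<le> e / c"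
    if [measurable]: "u \<in> borel_measurable ?P" and e: "(\<integral>\<^sup>+z. u z \<partial>?P) \<le> ennreal e" "0 \<le> e" and c: "0 < c"
    for u c e
  proof -
    have "1 \<le> ennreal (1 / c) * u z" if "ennreal c \<le> u z" for z
    proof -
      have "1 = ennreal (1 / c) * ennreal c" using c by (simp flip: ennreal_mult)
      also have "\<dots> \<le> ennreal (1 / c) * u z" using that by (intro mult_left_mono) auto
      finally show ?thesis .
    qed
    then have "emeasure ?P {z \<in> space ?P. ennreal c \<le> u z} \<le> emeasure ?P {z \<in> space ?P. 1 \<le> ennreal (1 / c) * u z}"
      by (intro emeasure_mono) auto
    also have "\<dots> \<le> ennreal (1 / c) * (\<integral>\<^sup>+z. u z * indicator (space ?P) z \<partial>?P)"
      by (rule nn_integral_Markov_inequality) auto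
    also have "(\<integral>\<^sup>+z. u z * indicator (space ?P) z \<partial>?P) = (\<integral>\<^sup>+z. u z \<partial>?P)"
      by (intro nn_integral_cong) auto
    also have "ennreal (1 / c) * \<dots> \<le> ennreal (1 / c) * ennreal e"
      using e by (intro mult_left_mono) auto
    also have "\<dots> = ennreal (e / c)" using c e by (simp flip: ennreal_mult)
    finally show ?thesis using c e by (simp add: P.emeasure_eq_measure)
  qed
  let ?c1 = "T * measure Q B" and ?c2 = "\<delta> * (measure Q B / T)"
  let ?EW = "{z \<in> space ?P. ennreal 1 \<le> ennreal (W z)}"
  let ?EI = "{z \<in> space ?P. ennreal ?c1 \<le> I z}"
  let ?EV = "{z \<in> space ?P. ennreal ?c2 \<le> V z}"
  have sub: "{z \<in> space ?P. \<bar>posterior Q n z A\<bar> > \<delta>} \<subseteq> ?EW \<union> ?EI \<union> ?EV"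
  proof (rule subsetI, rule ccontr)
    fix z assume z: "z \<in> {z \<in> space ?P. \<bar>posterior Q n z A\<bar> > \<delta>}" and nz: "z \<notin> ?EW \<union> ?EI \<union> ?EV"
    have zP: "z \<in> space ?P" using z by simp
    have W1: "W z < 1" and I1: "I z \<le> ennreal ?c1" and V1: "V z < ennreal ?c2"
      using nz zP by (auto simp: not_le ennreal_less_one_iff)
    have "(\<integral>\<^sup>+\<theta>\<in>A. ennreal (?R (step \<theta>) z) \<partial>Q) \<le> V z"
      unfolding V_def
    proof (rule nn_integral_mono)
      fix \<theta> assume "\<theta> \<in> space Q"
      show "ennreal (?R (step \<theta>) z) * indicator A \<theta> \<le> ennreal (?R (step \<theta>) z / W z) * indicator A \<theta>"
      proof (cases "\<theta> \<in> A")
        case True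
        then obtain g where "g \<in> G" using net by blast
        then have "0 < W z" using W_ge[of g z] less_le_trans[OF real_sqrt_gt_zero[OF lik_ratio_pos]] by blast
        then have "?R (step \<theta>) z \<le> ?R (step \<theta>) z / W z"
          using W1 lik_ratio_pos[of f0 "step \<theta>" n z] by (simp add: le_divide_eq)
        then show ?thesis using True by (simp add: ennreal_leI)
      qed simp
    qed
    then have VA: "(\<integral>\<^sup>+\<theta>\<in>A. ennreal (?R (step \<theta>) z) \<partial>Q) < ennreal ?c2" using V1 by simp
    have small: "\<bar>(LINT \<theta>:A|Q. ?R (step \<theta>) z) / (LINT \<theta>|Q. ?R (step \<theta>) z)\<bar> < \<delta>"
      using I1 unfolding I_def
      by (intro set_integral_ratio_less[OF Q A B integrable_lik_ratio[OF zP] lik_ratio_pos T pos _ VA])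
    show False
    proof (cases "(\<Prod>i=1..n. obs_density f0 (z i)) = 0")
      case True
      then show False using z \<delta> by (simp add: posterior_eq_0)
    next
      case False
      then show False using z small by (simp add: posterior_eq_lik_ratio)
    qed
  qed
  have "measure ?P {z \<in> space ?P. \<bar>posterior Q n z A\<bar> > \<delta>} \<le> measure ?P (?EW \<union> ?EI \<union> ?EV)"
  \<comment> \<open>A non-measurable set has \<open>measure\<close> zero by convention, so the bound
    holds in either case.\<close>
  proof (cases "{z \<in> space ?P. \<bar>posterior Q n z A\<bar> > \<delta>} \<in> sets ?P")
    case True then show ?thesis using sub by (intro P.finite_measure_mono) auto
  qed (simp add: measure_notin_sets)
  also have "\<dots> \<le> measure ?P ?EW + measure ?P ?EI + measure ?P ?EV"
    by (intro order_trans[OF measure_Un_le] add_right_mono measure_Un_le) measurable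
  also have "\<dots> \<le> card G * ?b / 1 + exp (exp (4 * L\<^sup>2)) * measure Q B / ?c1 + ?b / ?c2"
  proof (intro add_mono)
    show "measure ?P ?EW \<le> card G * ?b / 1"
      by (rule markov[OF _ EW]) auto
    show "measure ?P ?EI \<le> exp (exp (4 * L\<^sup>2)) * measure Q B / ?c1"
      using T pos by (intro markov[OF I_m EI]) auto
    show "measure ?P ?EV \<le> ?b / ?c2"
      using T pos \<delta> by (intro markov[OF V_m EV]) auto
  qed
  also have "\<dots> = exp (exp (4 * L\<^sup>2)) / T + (card G + T / (\<delta> * measure Q B)) * ?b"
    using pos by (simp add: algebra_simps)
  finally show ?thesis .
qed

end

subsection \<open>Step functions\<close>

lemma step_apply:
  "step (k, a, t) x = (\<Sum>j=1..k. a j * indicator {knot k t (j - 1)..<knot k t j} x)"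
  by (simp add: step_def)

section \<open>Measurability of step functions on the mixture space\<close>

lemma measurable_priorI:
  assumes "\<And>k. k \<in> {1..kmax} \<Longrightarrow> (\<lambda>x. f (k, x)) \<in> prior_k K \<pi>a \<pi>t k \<rightarrow>\<^sub>M N"
  shows "f \<in> prior K kmax p \<pi>a \<pi>t \<rightarrow>\<^sub>M N"
proof (rule measurableI)
  fix \<theta> assume "\<theta> \<in> space (prior K kmax p \<pi>a \<pi>t)"
  then show "f \<theta> \<in> space N"
    using measurable_space[OF assms] by (auto simp: space_prior space_prior_k Theta_def)
next
  fix B assume B: "B \<in> sets N"
  have "Pair k -` (f -` B \<inter> space (prior K kmax p \<pi>a \<pi>t))
      = (\<lambda>x. f (k, x)) -` B \<inter> space (prior_k K \<pi>a \<pi>t k)" if "k \<in> {1..kmax}" for k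
    using that by (auto simp: space_prior space_prior_k Theta_def)
  then show "f -` B \<inter> space (prior K kmax p \<pi>a \<pi>t) \<in> sets (prior K kmax p \<pi>a \<pi>t)"
    using measurable_sets[OF assms B] by (auto simp: sets_prior space_prior)
qed

lemma measurable_prior_k_fst:
  "fst \<in> prior_k K \<pi>a \<pi>t k \<rightarrow>\<^sub>M heights_lebesgue k"
  by (simp add: prior_k_def measurable_restrict_space1)

lemma measurable_prior_k_snd:
  "snd \<in> prior_k K \<pi>a \<pi>t k \<rightarrow>\<^sub>M points_lebesgue k"
  by (simp add: prior_k_def measurable_restrict_space1)

lemma measurable_step_prior:
  "(\<lambda>(\<theta>, x). step \<theta> x) \<in> borel_measurable (prior K kmax p \<pi>a \<pi>t \<Otimes>\<^sub>M borel)"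
proof -
  let ?Q = "prior K kmax p \<pi>a \<pi>t"
  \<comment> \<open>The number of segments varies with \<theta>. Setting heights beyond
    \<open>k\<close> to zero turns the sum into one over the fixed range \<open>{1..kmax}\<close>
    with measurable terms.\<close>
  define ht where "ht j \<theta> = (case \<theta> of (k, a, t) \<Rightarrow> if j \<in> {1..k} then a j else 0)"
    for j and \<theta> :: param
  define kt where "kt j \<theta> = (case \<theta> of (k, a, t) \<Rightarrow> knot k t j)" for j and \<theta> :: param
  have ht [measurable]: "ht j \<in> borel_measurable ?Q" for j
  proof (rule measurable_priorI)
    fix k
    show "(\<lambda>x. ht j (k, x)) \<in> borel_measurable (prior_k K \<pi>a \<pi>t k)"
    proof (cases "j \<in> {1..k}")
      case True
      then have "(\<lambda>a. a j) \<in> borel_measurable (heights_lebesgue k)"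
        unfolding heights_lebesgue_def by simp
      from measurable_compose[OF measurable_prior_k_fst this] show ?thesis
        using True by (simp add: ht_def case_prod_beta)
    next
      case False
      then have "(\<lambda>x. ht j (k, x)) = (\<lambda>_. 0)" by (auto simp: ht_def)
      then show ?thesis by simp
    qed
  qed
  have kt [measurable]: "kt j \<in> borel_measurable ?Q" for j
  proof (rule measurable_priorI)
    fix k
    show "(\<lambda>x. kt j (k, x)) \<in> borel_measurable (prior_k K \<pi>a \<pi>t k)"
      using measurable_compose[OF measurable_prior_k_snd measurable_knot[of k j]]
      by (simp add: kt_def case_prod_beta)
  qed
  have "(\<lambda>w. \<Sum>j=1..kmax. ht j (fst w) * (if kt (j - 1) (fst w) \<le> snd w \<and> snd w < kt j (fst w) then 1 else 0))
      \<in> borel_measurable (?Q \<Otimes>\<^sub>M borel)"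
    by measurable
  also have "?this \<longleftrightarrow> ?thesis"
  proof (rule measurable_cong)
    fix w assume "w \<in> space (?Q \<Otimes>\<^sub>M (borel :: real measure))"
    then obtain k a t x where w: "w = ((k, a, t), x)" and k: "k \<le> kmax"
      by (cases w) (auto simp: space_pair_measure space_prior Theta_def)
    have "(\<Sum>j=1..kmax. ht j (fst w) * (if kt (j - 1) (fst w) \<le> snd w \<and> snd w < kt j (fst w) then 1 else 0))
        = (\<Sum>j=1..k. a j * indicator {knot k t (j - 1)..<knot k t j} x)"
      using k by (intro sum.mono_neutral_cong_right) (auto simp: w ht_def kt_def)
    then show "(\<Sum>j=1..kmax. ht j (fst w) * (if kt (j - 1) (fst w) \<le> snd w \<and> snd w < kt j (fst w) then 1 else 0))
        = (case w of (\<theta>, x) \<Rightarrow> step \<theta> x)"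
      by (simp add: w step_apply)
  qed
  finally show ?thesis .
qed

lemma measurable_step [measurable]: "step (k, a, t) \<in> borel_measurable borel"
  unfolding step_def prod.case by measurable

text \<open>Each term is bounded separately, at the price of the factor \<open>k\<close>. The
  segments may therefore overlap, as can happen when the knots are not increasing.\<close>

lemma abs_step_le:
  assumes "\<And>j. j \<in> {1..k} \<Longrightarrow> \<bar>a j\<bar> \<le> C"
  shows "\<bar>step (k, a, t) x\<bar> \<le> real k * C"
proof -
  have "\<bar>step (k, a, t) x\<bar> \<le> (\<Sum>j=1..k. C)"
    unfolding step_apply
  proof (rule order_trans[OF sum_abs sum_mono])
    fix j assume "j \<in> {1..k}"
    then show "\<bar>a j * indicator {knot k t (j - 1)..<knot k t j} x\<bar> \<le> C"
      using assms[of j] by (auto split: split_indicator)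
  qed
  then show ?thesis by simp
qed

text \<open>
  Neither \<open>t\<close> nor \<open>t'\<close> is required to be increasing, so that grid points obtained by rounding need not
  satisfy the strict ordering of change-points.
\<close>

lemma sq_dist_step_le:
  assumes a': "\<And>j. j \<in> {1..k} \<Longrightarrow> \<bar>a' j\<bar> \<le> C"
    and aa: "\<And>j. j \<in> {1..k} \<Longrightarrow> \<bar>a j - a' j\<bar> \<le> d"
    and tt: "\<And>j. j \<in> {1..<k} \<Longrightarrow> \<bar>t j - t' j\<bar> \<le> e"
    and C: "0 \<le> C" and d: "0 \<le> d" and e: "0 \<le> e"
  shows "sq_dist (step (k, a, t)) (step (k, a', t')) \<le> 2 * (real k)\<^sup>2 * d\<^sup>2 + 8 * (real k)\<^sup>2 * C\<^sup>2 * e"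
proof -
  \<comment> \<open>\<open>b j\<close> is the stretch between the two positions of knot
    \<open>j\<close>. The two versions of segment \<open>j\<close> can differ only on
    \<open>b (j - 1)\<close> and \<open>b j\<close>, so \<open>N x\<close> dominates the number of
    segments affected at \<open>x\<close>.\<close>
  define b where "b j = {min (knot k t j) (knot k t' j)..<max (knot k t j) (knot k t' j)}" for j
  define N where "N x = (\<Sum>j=1..k. indicator (b (j - 1)) x + indicator (b j) x :: real)" for x :: real
  have kn: "\<bar>knot k t j - knot k t' j\<bar> \<le> e" for j
    using tt[of j] e by (simp add: knot_def)
  have N_m [measurable]: "N \<in> borel_measurable borel"
    unfolding N_def b_def by measurable
  have N0: "0 \<le> N x" for x
    unfolding N_def by (intro sum_nonneg add_nonneg_nonneg) auto
  have N2: "N x \<le> 2 * real k" for x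
  proof -
    have "N x \<le> (\<Sum>j=1..k. 1 + 1)"
      unfolding N_def by (intro sum_mono add_mono) (auto split: split_indicator)
    then show ?thesis by simp
  qed
  have ib: "(LINT x|unif. indicator (b j) x) \<le> e" for j
  proof -
    have "(LINT x|unif. indicator (b j) x) = measure unif (b j)"
      by (simp add: b_def)
    also have "\<dots> = measure lborel ({0..<1} \<inter> b j)"
      by (subst measure_uniform_measure) (auto simp: b_def)
    also have "\<dots> \<le> measure lborel (b j)"
      by (intro measure_mono_fmeasurable) (auto simp: b_def fmeasurable_def)
    also have "\<dots> \<le> e" using kn[of j] by (auto simp: b_def)
    finally show ?thesis .
  qed
  have iN: "integrable unif N"
    using N0 N2 by (intro unif.integrable_const_bound[where B = "2 * real k"]) auto
  have EN: "(LINT x|unif. N x) \<le> 2 * real k * e"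
  proof -
    have [simp]: "integrable unif (\<lambda>x. indicator (b j) x :: real)" for j
      by (intro unif.integrable_const_bound[where B = 1]) (auto simp: b_def)
    have "(LINT x|unif. N x) = (\<Sum>j=1..k. (LINT x|unif. indicator (b (j - 1)) x) + (LINT x|unif. indicator (b j) x))"
      unfolding N_def by simp
    also have "\<dots> \<le> (\<Sum>j=1..k. e + e)" by (intro sum_mono add_mono ib)
    finally show ?thesis by simp
  qed
  have diff: "\<bar>step (k, a, t) x - step (k, a', t') x\<bar> \<le> real k * d + C * N x" for x
  proof -
    let ?I = "\<lambda>t j. indicator {knot k t (j - 1)..<knot k t j} x :: real"
    have "\<bar>step (k, a, t) x - step (k, a', t') x\<bar>
        \<le> (\<Sum>j=1..k. \<bar>a j * ?I t j - a' j * ?I t' j\<bar>)"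
      unfolding step_apply sum_subtractf[symmetric] by (rule sum_abs)
    also have "\<dots> \<le> (\<Sum>j=1..k. d + C * (indicator (b (j - 1)) x + indicator (b j) x))"
    proof (rule sum_mono)
      fix j assume j: "j \<in> {1..k}"
      have "\<bar>a j * ?I t j - a' j * ?I t' j\<bar> = \<bar>(a j - a' j) * ?I t j + a' j * (?I t j - ?I t' j)\<bar>"
        by (simp add: algebra_simps)
      also have "\<dots> \<le> \<bar>a j - a' j\<bar> * \<bar>?I t j\<bar> + \<bar>a' j\<bar> * \<bar>?I t j - ?I t' j\<bar>"
        by (rule order_trans[OF abs_triangle_ineq]) (simp add: abs_mult)
      also have "\<dots> \<le> d * 1 + C * (indicator (b (j - 1)) x + indicator (b j) x)"
        using j by (intro add_mono mult_mono aa a' C d) (auto simp: b_def split: split_indicator)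
      finally show "\<bar>a j * ?I t j - a' j * ?I t' j\<bar> \<le> d + C * (indicator (b (j - 1)) x + indicator (b j) x)"
        by simp
    qed
    also have "\<dots> = real k * d + C * N x"
      by (simp add: N_def sum.distrib distrib_left flip: sum_distrib_left)
    finally show ?thesis .
  qed
  have sq: "(step (k, a, t) x - step (k, a', t') x)\<^sup>2 \<le> 2 * (real k)\<^sup>2 * d\<^sup>2 + 4 * real k * C\<^sup>2 * N x" for x
  proof -
    have "(step (k, a, t) x - step (k, a', t') x)\<^sup>2 \<le> (real k * d + C * N x)\<^sup>2"
      using power_mono[OF diff[of x], of 2] by simp
    also have "\<dots> \<le> 2 * (real k * d)\<^sup>2 + 2 * (C * N x)\<^sup>2"
      using sum_squares_bound[of "real k * d" "C * N x"] by (simp add: power2_sum)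
    \<comment> \<open>Because \<open>N x \<le> 2 * real k\<close>, the square of \<open>N x\<close>
      is replaced by a multiple of \<open>N x\<close>. This makes the squared distance linear in the
      knot displacement \<open>e\<close>.\<close>
    also have "(C * N x)\<^sup>2 \<le> C\<^sup>2 * (2 * real k * N x)"
      unfolding power_mult_distrib power2_eq_square[of "N x"]
      by (intro mult_left_mono mult_right_mono N2 N0) simp
    finally show ?thesis by (simp add: power_mult_distrib mult_ac)
  qed
  have iR: "integrable unif (\<lambda>x. 2 * (real k)\<^sup>2 * d\<^sup>2 + 4 * real k * C\<^sup>2 * N x)"
    using iN by simp
  have "sq_dist (step (k, a, t)) (step (k, a', t')) = (LINT x|unif. (step (k, a, t) x - step (k, a', t') x)\<^sup>2)"
    by (rule sq_dist_unif) measurable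
  also have "\<dots> \<le> (LINT x|unif. 2 * (real k)\<^sup>2 * d\<^sup>2 + 4 * real k * C\<^sup>2 * N x)"
  proof (rule integral_mono[OF _ iR sq])
    show "integrable unif (\<lambda>x. (step (k, a, t) x - step (k, a', t') x)\<^sup>2)"
      by (rule Bochner_Integration.integrable_bound[OF iR])
        (auto intro!: AE_I2 order_trans[OF sq] abs_ge_self)
  qed
  also have "\<dots> = 2 * (real k)\<^sup>2 * d\<^sup>2 + 4 * real k * C\<^sup>2 * (LINT x|unif. N x)"
    using iN by (simp add: unif.prob_space)
  also have "\<dots> \<le> 2 * (real k)\<^sup>2 * d\<^sup>2 + 4 * real k * C\<^sup>2 * (2 * real k * e)"
    by (intro add_left_mono mult_left_mono EN) simp
  also have "\<dots> = 2 * (real k)\<^sup>2 * d\<^sup>2 + 8 * (real k)\<^sup>2 * C\<^sup>2 * e"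
    by (simp add: power2_eq_square)
  finally show ?thesis .
qed

section \<open>A finite net of polynomial size\<close>

text \<open>Rounding down to a multiple of \<open>1 / n\<close> moves \<open>x\<close> by at most
  \<open>1 / n \<le> 1\<close>; the slack in \<open>r + 1 \<le> real R\<close> leaves room for
  this.\<close>

lemma floor_grid:
  fixes x r :: real and n R :: nat
  assumes n: "1 \<le> n" and x: "\<bar>x\<bar> \<le> r" "r + 1 \<le> real R"
  defines "y \<equiv> of_int \<lfloor>x * real n\<rfloor> / real n"
  shows "y \<in> (\<lambda>i::int. of_int i / real n) ` {- int (n * R)..int (n * R)}"
    and "\<bar>x - y\<bar> \<le> 1 / real n" and "\<bar>y\<bar> \<le> real R"
proof -
  have n0: "0 < real n" using n by simp
  have "x * real n - 1 \<le> of_int \<lfloor>x * real n\<rfloor>" "of_int \<lfloor>x * real n\<rfloor> \<le> x * real n" by linarith+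
  from this[THEN divide_right_mono[OF _ less_imp_le[OF n0]]]
  have y: "x - 1 / real n \<le> y" "y \<le> x" using n0 by (simp_all add: y_def diff_divide_distrib)
  have n1: "1 / real n \<le> 1" using n by simp
  show xy: "\<bar>x - y\<bar> \<le> 1 / real n" using y by simp
  show yR: "\<bar>y\<bar> \<le> real R" using y x n1 by linarith
  have "\<bar>of_int \<lfloor>x * real n\<rfloor>\<bar> = \<bar>y\<bar> * real n" using n0 by (simp add: y_def abs_mult)
  also have "\<dots> \<le> real R * real n" using yR by (intro mult_right_mono) auto
  finally have "\<bar>real_of_int \<lfloor>x * real n\<rfloor>\<bar> \<le> of_int (int (n * R))" by (simp add: mult.commute)
  then have "\<bar>\<lfloor>x * real n\<rfloor>\<bar> \<le> int (n * R)" by linarith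
  then show "y \<in> (\<lambda>i::int. of_int i / real n) ` {- int (n * R)..int (n * R)}"
    unfolding y_def by (intro imageI) auto
qed

lemma change_points_bounds:
  assumes t: "t \<in> change_points k" and j: "j \<in> {1..<k}"
  shows "0 \<le> t j" "t j \<le> 1"
proof -
  have lt: "knot k t (i - 1) < knot k t i" if "i \<in> {1..k}" for i
    using t that by (simp add: change_points_def)
  have lo: "knot k t 0 \<le> knot k t i" if "i \<le> k" for i
    using that
  proof (induction i)
    case (Suc i)
    then show ?case using lt[of "Suc i"] by simp
  qed simp
  have hi: "knot k t i \<le> knot k t k" if "i \<le> k" for i
    using that
  proof (induction rule: inc_induct)
    case (step i)
    then show ?case using lt[of "Suc i"] by simp
  qed simp
  show "0 \<le> t j" "t j \<le> 1"
    using lo[of j] hi[of j] j by (simp_all add: knot_def)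
qed

text \<open>Heights and knots are rounded to a grid of mesh \<open>1 / n\<close> with at most
  \<open>2 * n * R + 1 \<le> 3 * n * R\<close> points. A model with \<open>k\<close> segments has
  \<open>2 * k - 1\<close> coordinates, whence the exponent. The constant 10 is the sum of 2 and 8
  from \<open>sq_dist_step_le\<close>, after \<open>(1 / n)\<^sup>2\<close> is bounded by
  \<open>(real R)\<^sup>2 / n\<close>.\<close>

lemma step_net:
  fixes K :: real and n R kmax :: nat
  assumes n: "1 \<le> n" and K: "0 < K" "K + 2 \<le> real R"
  obtains G where "finite G" "real (card G) \<le> real kmax * (3 * real n * real R) ^ (2 * kmax)"
    "\<And>g. g \<in> G \<Longrightarrow> g \<in> borel_measurable borel"
    "\<And>g x. g \<in> G \<Longrightarrow> \<bar>g x\<bar> \<le> real kmax * real R"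
    "\<And>\<theta>. \<theta> \<in> Theta K kmax \<Longrightarrow> \<exists>g\<in>G. sq_dist (step \<theta>) g \<le> 10 * (real kmax * real R)\<^sup>2 / real n"
proof
  define S where "S = (\<lambda>i::int. of_int i / real n) ` {- int (n * R)..int (n * R)}"
  define P where "P = (SIGMA k:{1..kmax}. ({1..k} \<rightarrow>\<^sub>E S) \<times> ({1..<k} \<rightarrow>\<^sub>E S))"
  have R: "1 \<le> real R" using K by linarith
  have finS: "finite S" by (simp add: S_def)
  have S_le: "\<bar>s\<bar> \<le> real R" if s: "s \<in> S" for s
  proof -
    obtain i where i: "s = of_int i / real n" "i \<in> {- int (n * R)..int (n * R)}"
      using s unfolding S_def by blast
    then have "\<bar>i\<bar> \<le> int (n * R)" by auto
    then have "\<bar>real_of_int i\<bar> \<le> of_int (int (n * R))" by linarith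
    then show ?thesis using n by (simp add: i(1) divide_le_eq mult.commute)
  qed
  have cS: "real (card S) \<le> 3 * real n * real R"
  proof -
    have "card S \<le> card {- int (n * R)..int (n * R)}"
      unfolding S_def by (rule card_image_le) simp
    also have "\<dots> = 2 * (n * R) + 1"
      unfolding card_atLeastAtMost_int by arith
    finally have "real (card S) \<le> real (2 * (n * R) + 1)"
      by (simp only: of_nat_le_iff)
    then have "real (card S) \<le> 2 * (real n * real R) + 1" by simp
    moreover have "1 * 1 \<le> real n * real R" using n R by (intro mult_mono) auto
    ultimately show ?thesis by simp
  qed
  have c1: "1 \<le> 3 * real n * real R" using mult_mono[of 1 "real n" 1 "real R"] n R by simp
  show fin: "finite (step ` P)"
    unfolding P_def by (intro finite_imageI finite_SigmaI finite_cartesian_product finite_PiE finS) auto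
  show "real (card (step ` P)) \<le> real kmax * (3 * real n * real R) ^ (2 * kmax)"
  proof -
    have "card (step ` P) \<le> card P"
      unfolding P_def by (intro card_image_le finite_SigmaI finite_cartesian_product finite_PiE finS) auto
    also have "card P = (\<Sum>k=1..kmax. card S ^ k * card S ^ (k - 1))"
      unfolding P_def
      by (subst card_SigmaI) (auto simp: card_cartesian_product card_PiE intro!: finite_cartesian_product finite_PiE finS)
    finally have "real (card (step ` P)) \<le> real (\<Sum>k=1..kmax. card S ^ k * card S ^ (k - 1))"
      by (simp only: of_nat_le_iff)
    also have "\<dots> = (\<Sum>k=1..kmax. real (card S) ^ k * real (card S) ^ (k - 1))" by simp
    also have "\<dots> \<le> (\<Sum>k=1..kmax. (3 * real n * real R) ^ (2 * kmax))"
    proof (rule sum_mono)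
      fix k assume k: "k \<in> {1..kmax}"
      have "real (card S) ^ k * real (card S) ^ (k - 1) = real (card S) ^ (k + (k - 1))"
        by (simp add: power_add)
      also have "\<dots> \<le> (3 * real n * real R) ^ (k + (k - 1))" by (intro power_mono cS) simp
      also have "\<dots> \<le> (3 * real n * real R) ^ (2 * kmax)"
        using k c1 by (intro power_increasing) auto
      finally show "real (card S) ^ k * real (card S) ^ (k - 1) \<le> (3 * real n * real R) ^ (2 * kmax)" .
    qed
    finally show ?thesis by simp
  qed
  show "g \<in> borel_measurable borel" if "g \<in> step ` P" for g
    using that by (auto simp: P_def)
  show "\<bar>g x\<bar> \<le> real kmax * real R" if g: "g \<in> step ` P" for g x
  proof -
    obtain k a t where g: "g = step (k, a, t)" "k \<le> kmax" "a \<in> {1..k} \<rightarrow>\<^sub>E S"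
      using g by (auto simp: P_def)
    have "\<bar>g x\<bar> \<le> real k * real R"
      unfolding g(1) using g(3) by (intro abs_step_le S_le) auto
    also have "\<dots> \<le> real kmax * real R" using g(2) by (intro mult_right_mono) auto
    finally show ?thesis .
  qed
  show "\<exists>g\<in>step ` P. sq_dist (step \<theta>) g \<le> 10 * (real kmax * real R)\<^sup>2 / real n"
    if \<theta>: "\<theta> \<in> Theta K kmax" for \<theta>
  proof -
    obtain k a t where kat: "\<theta> = (k, a, t)" "k \<in> {1..kmax}" "a \<in> heights K k" "t \<in> change_points k"
      using \<theta> by (auto simp: Theta_def Theta_k_def)
    let ?f = "\<lambda>x. of_int \<lfloor>x * real n\<rfloor> / real n :: real"
    define a' t' where "a' = (\<lambda>j\<in>{1..k}. ?f (a j))" and "t' = (\<lambda>j\<in>{1..<k}. ?f (t j))"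
    have aK: "\<bar>a j\<bar> \<le> K" if "j \<in> {1..k}" for j
      using kat(3) that by (auto simp: heights_def abs_le_iff dest!: PiE_mem[where x = j])
    have t1: "\<bar>t j\<bar> \<le> 1" if "j \<in> {1..<k}" for j
      using change_points_bounds[OF kat(4) that] by simp
    \<comment> \<open>One grid serves both roundings: heights are bounded by \<open>K\<close> and
      knots by 1, each with a unit of slack below \<open>R\<close>.\<close>
    have KR: "K + 1 \<le> real R" "1 + 1 \<le> real R" using K by linarith+
    note fa = floor_grid[OF n aK KR(1)] and ft = floor_grid[OF n t1 KR(2)]
    have "(k, a', t') \<in> P"
      using kat(2) fa(1) ft(1) by (auto simp: P_def S_def a'_def t'_def)
    moreover have "sq_dist (step (k, a, t)) (step (k, a', t')) \<le> 10 * (real kmax * real R)\<^sup>2 / real n"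
    proof -
      have "sq_dist (step (k, a, t)) (step (k, a', t'))
          \<le> 2 * (real k)\<^sup>2 * (1 / real n)\<^sup>2 + 8 * (real k)\<^sup>2 * (real R)\<^sup>2 * (1 / real n)"
        using fa(2,3) ft(2) by (intro sq_dist_step_le) (auto simp: a'_def t'_def)
      also have "\<dots> \<le> 2 * (real k)\<^sup>2 * ((real R)\<^sup>2 * (1 / real n)) + 8 * (real k)\<^sup>2 * (real R)\<^sup>2 * (1 / real n)"
      proof (intro add_right_mono mult_left_mono)
        have "(1 / real n)\<^sup>2 \<le> 1 * (1 / real n)"
          unfolding power2_eq_square using n by (intro mult_right_mono) auto
        also have "\<dots> \<le> (real R)\<^sup>2 * (1 / real n)"
          using R by (intro mult_right_mono) (auto simp: one_le_power)
        finally show "(1 / real n)\<^sup>2 \<le> (real R)\<^sup>2 * (1 / real n)" .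
      qed simp
      also have "\<dots> = 10 * ((real k)\<^sup>2 * (real R)\<^sup>2) / real n" by (simp add: field_simps)
      also have "\<dots> \<le> 10 * ((real kmax)\<^sup>2 * (real R)\<^sup>2) / real n"
        using kat(2) by (intro divide_right_mono mult_left_mono mult_right_mono power_mono) auto
      finally show ?thesis by (simp add: power_mult_distrib)
    qed
    ultimately show ?thesis unfolding kat(1) by blast
  qed
qed

subsection \<open>Prior mass near the truth\<close>

lemma borel_measurable_prior_density:
  assumes "prior_densities K kmax \<pi>a \<pi>t" and k: "k \<in> {1..kmax}"
  shows "(\<lambda>(a, t). ennreal (\<pi>a k a t * \<pi>t k t))
    \<in> borel_measurable (restrict_space (heights_lebesgue k \<Otimes>\<^sub>M points_lebesgue k) (Theta_k K k))"
proof -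
  let ?M = "restrict_space (heights_lebesgue k \<Otimes>\<^sub>M points_lebesgue k) (Theta_k K k)"
  have m: "(\<lambda>(a, t). \<pi>a k a t) \<in> borel_measurable ?M"
    "\<pi>t k \<in> borel_measurable (restrict_space (points_lebesgue k) (change_points k))"
    using assms unfolding prior_densities_def by blast+
  have "snd \<in> ?M \<rightarrow>\<^sub>M restrict_space (points_lebesgue k) (change_points k)"
    by (intro measurable_restrict_space3) (auto simp: Theta_k_def)
  from borel_measurable_times[OF m(1) measurable_compose[OF this m(2)]]
  have "(\<lambda>z. ennreal ((case z of (a, t) \<Rightarrow> \<pi>a k a t) * \<pi>t k (snd z))) \<in> borel_measurable ?M"
    by simp
  then show ?thesis by (simp add: case_prod_beta)
qed

lemma emeasure_prior_k_ge:
  assumes d: "prior_densities K kmax \<pi>a \<pi>t" and k: "k \<in> {1..kmax}"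
    and U: "U \<in> sets (heights_lebesgue k)" "U \<subseteq> heights K k"
    and V: "V \<in> sets (points_lebesgue k)" "V \<subseteq> change_points k"
    and lower: "\<And>a t. a \<in> heights K k \<Longrightarrow> t \<in> change_points k \<Longrightarrow> c \<le> \<pi>a k a t * \<pi>t k t"
  shows "U \<times> V \<in> sets (prior_k K \<pi>a \<pi>t k)"
    and "ennreal c * (emeasure (heights_lebesgue k) U * emeasure (points_lebesgue k) V)
      \<le> emeasure (prior_k K \<pi>a \<pi>t k) (U \<times> V)"
proof -
  interpret product_sigma_finite "\<lambda>_::nat. lborel :: real measure" ..
  interpret T: sigma_finite_measure "points_lebesgue k"
    unfolding points_lebesgue_def by (rule sigma_finite) simp
  let ?M = "heights_lebesgue k \<Otimes>\<^sub>M points_lebesgue k"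
  let ?R = "restrict_space ?M (Theta_k K k)"
  have sub: "U \<times> V \<subseteq> Theta_k K k" using U V by (auto simp: Theta_k_def)
  have UV: "U \<times> V \<in> sets ?R"
    using U V sub by (simp add: sets_restrict_space_iff)
  then show "U \<times> V \<in> sets (prior_k K \<pi>a \<pi>t k)" by (simp add: prior_k_def)
  have "ennreal c * (emeasure (heights_lebesgue k) U * emeasure (points_lebesgue k) V)
      = ennreal c * emeasure ?R (U \<times> V)"
    using U V sub by (simp add: emeasure_restrict_space T.emeasure_pair_measure_Times)
  also have "\<dots> = (\<integral>\<^sup>+z. ennreal c * indicator (U \<times> V) z \<partial>?R)"
    using UV by (simp add: nn_integral_cmult)
  also have "\<dots> \<le> (\<integral>\<^sup>+z. (case z of (a, t) \<Rightarrow> ennreal (\<pi>a k a t * \<pi>t k t)) * indicator (U \<times> V) z \<partial>?R)"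
    using U V by (intro nn_integral_mono)
      (auto split: split_indicator intro!: ennreal_leI lower)
  also have "\<dots> = emeasure (prior_k K \<pi>a \<pi>t k) (U \<times> V)"
    unfolding prior_k_def by (rule emeasure_density[OF borel_measurable_prior_density[OF d k] UV, symmetric])
  finally show "ennreal c * (emeasure (heights_lebesgue k) U * emeasure (points_lebesgue k) V)
      \<le> emeasure (prior_k K \<pi>a \<pi>t k) (U \<times> V)" .
qed

text \<open>A box of side \<open>r / n\<close> at the true parameter lies in the model and has
  Lebesgue volume \<open>(r / n) ^ (2 * k0 - 1)\<close>. The lower bounds on the densities carry
  this over to the prior.\<close>

lemma prior_mass_near:
  assumes K: "K > 0" and p: "\<forall>k\<in>{1..kmax}. p k > 0"
    and d: "prior_densities K kmax \<pi>a \<pi>t" and A: "assumption_A K kmax \<pi>a \<pi>t"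
    and prob: "prob_space (prior K kmax p \<pi>a \<pi>t)"
    and \<theta>0: "(k0, a0, t0) \<in> Theta K kmax"
  obtains c :: real and q :: nat where "0 < c"
    "\<And>n. 1 \<le> n \<Longrightarrow> \<exists>B\<in>sets (prior K kmax p \<pi>a \<pi>t).
      c * (1 / real n) ^ q \<le> measure (prior K kmax p \<pi>a \<pi>t) B \<and>
      (\<forall>\<theta>\<in>B. real n * sq_dist (step \<theta>) (step (k0, a0, t0)) \<le> 1)"
proof -
  interpret P: prob_space "prior K kmax p \<pi>a \<pi>t" by (rule prob)
  interpret product_sigma_finite "\<lambda>_::nat. lborel :: real measure" ..
  have k0: "k0 \<in> {1..kmax}" and a0: "a0 \<in> heights K k0" and t0: "t0 \<in> change_points k0"
    using \<theta>0 by (auto simp: Theta_def Theta_k_def)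
  have a0K: "- K \<le> a0 j" "a0 j \<le> K" if "j \<in> {1..k0}" for j
    using a0 that by (auto simp: heights_def dest!: PiE_mem[where x = j])
  obtain ca ct where ca: "0 < ca" "\<And>a t. a \<in> heights K k0 \<Longrightarrow> t \<in> change_points k0 \<Longrightarrow> ca \<le> \<pi>a k0 a t"
    and ct: "0 < ct" "\<And>t. t \<in> change_points k0 \<Longrightarrow> ct \<le> \<pi>t k0 t"
  proof -
    have "bounded_away_from_0_inf (Theta_k K k0) (\<lambda>(a, t). \<pi>a k0 a t)"
      and "bounded_away_from_0_inf (change_points k0) (\<pi>t k0)"
      using A k0 unfolding assumption_A_def by blast+
    then show ?thesis
      using that unfolding bounded_away_from_0_inf_def Theta_k_def by (auto dest: bspec)
  qed
  \<comment> \<open>The constant of \<open>sq_dist_step_le\<close> when heights and knots both move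
    by at most \<open>e \<le> 1\<close> and \<open>C = K\<close>.\<close>
  define D where "D = 2 * (real k0)\<^sup>2 + 8 * (real k0)\<^sup>2 * K\<^sup>2"
  have D: "0 < D" unfolding D_def using k0 by (intro add_pos_nonneg) auto
  have gap: "0 < knot k0 t0 j - knot k0 t0 (j - 1)" if "j \<in> {1..k0}" for j
    using t0 that by (simp add: change_points_def)
  \<comment> \<open>\<open>r < K\<close> keeps the heights in range, \<open>r < 1\<close> gives
    \<open>e\<^sup>2 \<le> e\<close>, \<open>r < 1 / D\<close> gives the distance bound, and the
    last condition keeps the shifted knots increasing.\<close>
  have "\<forall>\<^sub>F r in at_right (0::real). 0 < r \<and> r < K \<and> r < 1 \<and> r < 1 / D \<and>
      (\<forall>j\<in>{1..k0}. r < knot k0 t0 j - knot k0 t0 (j - 1))"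
  proof -
    have lt: "\<forall>\<^sub>F r in at_right (0::real). r < b" if "0 < b" for b
      using tendsto_ident_at that by (rule order_tendstoD(2))
    show ?thesis
      using K D gap by (intro eventually_conj eventually_ball_finite ballI eventually_at_right_less lt) auto
  qed
  from eventually_happens'[OF trivial_limit_at_right_real this]
  obtain r where r: "0 < r" "r < K" "r < 1" "r < 1 / D"
    and rgap: "\<And>j. j \<in> {1..k0} \<Longrightarrow> r < knot k0 t0 j - knot k0 t0 (j - 1)"
    by blast
  let ?q = "k0 + (k0 - 1)"
  show ?thesis
  proof (rule that)
    show "0 < p k0 * (ca * ct) * r ^ ?q"
      using p k0 ca(1) ct(1) r(1) by simp
    fix n :: nat assume n: "1 \<le> n"
    define e where "e = r / real n"
    have e: "0 < e" "e \<le> r" using r n by (simp_all add: e_def divide_le_eq)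
    \<comment> \<open>A true height may sit on the boundary of \<open>{-K..K}\<close>, so its
      interval extends from \<open>a0 j\<close> towards zero and stays inside because
      \<open>e < K\<close>.\<close>
    define lo where "lo j = (if 0 \<le> a0 j then a0 j - e else a0 j)" for j
    define U where "U = (\<Pi>\<^sub>E j\<in>{1..k0}. {lo j..lo j + e})"
    \<comment> \<open>Knots only move to the right and by at most \<open>e\<close>, so each one
      stays below its right neighbour's original position.\<close>
    define V where "V = (\<Pi>\<^sub>E j\<in>{1..<k0}. {t0 j..t0 j + e})"
    let ?B = "{k0} \<times> (U \<times> V)"
    have U: "U \<in> sets (heights_lebesgue k0)"
      unfolding U_def heights_lebesgue_def by (intro sets_PiM_I_finite) auto
    have V: "V \<in> sets (points_lebesgue k0)"
      unfolding V_def points_lebesgue_def by (intro sets_PiM_I_finite) auto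
    have UK: "U \<subseteq> heights K k0"
      unfolding U_def heights_def
    proof (rule PiE_mono)
      fix j assume j: "j \<in> {1..k0}"
      show "{lo j..lo j + e} \<subseteq> {- K..K}" using a0K[OF j] e r(2) by (auto simp: lo_def)
    qed
    have VT: "V \<subseteq> change_points k0"
    proof
      fix t assume t: "t \<in> V"
      have near: "knot k0 t0 j \<le> knot k0 t j" "knot k0 t j \<le> knot k0 t0 j + e" for j
        using t e(1) by (auto simp: V_def knot_def dest!: PiE_mem[where x = j])
      have "knot k0 t (j - 1) < knot k0 t j" if "j \<in> {1..k0}" for j
        using near[of j] near[of "j - 1"] rgap[OF that] e(2) by linarith
      then show "t \<in> change_points k0" using t by (auto simp: change_points_def V_def PiE_def)
    qed
    have c: "ca * ct \<le> \<pi>a k0 a t * \<pi>t k0 t" if "a \<in> heights K k0" "t \<in> change_points k0" for a t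
      using ca ct that by (intro mult_mono) (auto intro: order_trans[OF less_imp_le])
    have UV: "U \<times> V \<in> sets (prior_k K \<pi>a \<pi>t k0)"
      by (rule emeasure_prior_k_ge(1)[OF d k0 U UK V VT c])
    have mUV: "ennreal (ca * ct) * (emeasure (heights_lebesgue k0) U * emeasure (points_lebesgue k0) V)
        \<le> emeasure (prior_k K \<pi>a \<pi>t k0) (U \<times> V)"
      by (rule emeasure_prior_k_ge(2)[OF d k0 U UK V VT c])
    have vimage: "Pair k -` ?B = (if k = k0 then U \<times> V else {})" for k by auto
    have "U \<times> V \<subseteq> Theta_k K k0" using UK VT by (auto simp: Theta_k_def)
    then have B: "?B \<in> sets (prior K kmax p \<pi>a \<pi>t)"
      using UV k0 unfolding sets_prior vimage by (auto simp: Theta_def)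
    have eU: "emeasure (heights_lebesgue k0) U = ennreal (e ^ k0)"
      unfolding U_def heights_lebesgue_def using e
      by (subst emeasure_PiM) (auto simp: prod_ennreal ennreal_power)
    have eV: "emeasure (points_lebesgue k0) V = ennreal (e ^ (k0 - 1))"
      unfolding V_def points_lebesgue_def using e
      by (subst emeasure_PiM) (auto simp: prod_ennreal ennreal_power)
    have "ennreal (p k0 * (ca * ct) * e ^ ?q)
        = ennreal (p k0) * (ennreal (ca * ct) * (ennreal (e ^ k0) * ennreal (e ^ (k0 - 1))))"
      unfolding power_add using bspec[OF p k0] ca(1) ct(1) e(1)
      by (simp add: mult.assoc flip: ennreal_mult)
    also have "\<dots> \<le> ennreal (p k0) * emeasure (prior_k K \<pi>a \<pi>t k0) (U \<times> V)"
      using mUV unfolding eU eV by (rule mult_left_mono) (rule zero_le)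
    also have "\<dots> = (\<Sum>k=1..kmax. if k = k0 then ennreal (p k0) * emeasure (prior_k K \<pi>a \<pi>t k0) (U \<times> V) else 0)"
      using k0 by simp
    also have "\<dots> = emeasure (prior K kmax p \<pi>a \<pi>t) ?B"
      unfolding emeasure_prior[OF B] vimage by (intro sum.cong) auto
    finally have mass: "p k0 * (ca * ct) * e ^ ?q \<le> measure (prior K kmax p \<pi>a \<pi>t) ?B"
      by (simp add: P.emeasure_eq_measure)
    have "real n * sq_dist (step \<theta>) (step (k0, a0, t0)) \<le> 1" if "\<theta> \<in> ?B" for \<theta>
    proof -
      obtain a t where \<theta>: "\<theta> = (k0, a, t)" "a \<in> U" "t \<in> V" using \<open>\<theta> \<in> ?B\<close> by auto
      have "sq_dist (step (k0, a, t)) (step (k0, a0, t0)) \<le> 2 * (real k0)\<^sup>2 * e\<^sup>2 + 8 * (real k0)\<^sup>2 * K\<^sup>2 * e"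
      proof (rule sq_dist_step_le)
        fix j assume j: "j \<in> {1..k0}"
        show "\<bar>a0 j\<bar> \<le> K" using a0K[OF j] by simp
        have "a j \<in> {lo j..lo j + e}" using \<theta>(2) j unfolding U_def by (rule PiE_mem)
        then show "\<bar>a j - a0 j\<bar> \<le> e" using e by (auto simp: lo_def split: if_splits)
      next
        fix j assume j: "j \<in> {1..<k0}"
        have "t j \<in> {t0 j..t0 j + e}" using \<theta>(3) j unfolding V_def by (rule PiE_mem)
        then show "\<bar>t j - t0 j\<bar> \<le> e" by auto
      qed (use K e in auto)
      also have "\<dots> \<le> 2 * (real k0)\<^sup>2 * e + 8 * (real k0)\<^sup>2 * K\<^sup>2 * e"
      proof -
        have "e * e \<le> 1 * e" using e r by (intro mult_right_mono) auto
        then have "2 * (real k0)\<^sup>2 * e\<^sup>2 \<le> 2 * (real k0)\<^sup>2 * e"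
          by (intro mult_left_mono) (auto simp: power2_eq_square)
        then show ?thesis by simp
      qed
      also have "\<dots> = D * e" by (simp add: D_def algebra_simps)
      finally have "real n * sq_dist (step (k0, a, t)) (step (k0, a0, t0)) \<le> real n * (D * e)"
        by (intro mult_left_mono) auto
      also have "\<dots> = D * r" using n by (simp add: e_def)
      also have "\<dots> \<le> 1" using r(4) D by (simp add: field_simps)
      finally show ?thesis by (simp add: \<theta>(1))
    qed
    then show "\<exists>B\<in>sets (prior K kmax p \<pi>a \<pi>t).
        p k0 * (ca * ct) * r ^ ?q * (1 / real n) ^ ?q \<le> measure (prior K kmax p \<pi>a \<pi>t) B \<and>
        (\<forall>\<theta>\<in>B. real n * sq_dist (step \<theta>) (step (k0, a0, t0)) \<le> 1)"
      using mass B by (intro bexI[of _ ?B]) (auto simp: e_def power_divide)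
  qed
qed

subsection \<open>Posterior contraction\<close>

text \<open>From \<open>(u + v)\<^sup>2 \<le> 2 * u\<^sup>2 + 2 * v\<^sup>2\<close>. It shows that a
  net point close to a parameter far from the truth is itself far from the truth.\<close>

lemma sq_dist_triangle:
  assumes [measurable]: "f \<in> borel_measurable borel" "g \<in> borel_measurable borel" "h \<in> borel_measurable borel"
    and bd: "\<And>x. \<bar>f x\<bar> \<le> L" "\<And>x. \<bar>g x\<bar> \<le> L" "\<And>x. \<bar>h x\<bar> \<le> L"
  shows "sq_dist f h \<le> 2 * sq_dist f g + 2 * sq_dist g h"
proof -
  have int: "integrable unif (\<lambda>x. (u x - v x)\<^sup>2)"
    if "u \<in> borel_measurable borel" "v \<in> borel_measurable borel" "\<And>x. \<bar>u x\<bar> \<le> L" "\<And>x. \<bar>v x\<bar> \<le> L"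
    for u v :: "real \<Rightarrow> real"
    by (rule unif.integrable_const_bound[where B = "4 * L\<^sup>2"]) (use that sq_diff_le in auto)
  note i = int[OF assms(1,3) bd(1,3)] int[OF assms(1,2) bd(1,2)] int[OF assms(2,3) bd(2,3)]
  have "sq_dist f h = (LINT x|unif. (f x - h x)\<^sup>2)" by (rule sq_dist_unif) measurable
  also have "\<dots> \<le> (LINT x|unif. 2 * (f x - g x)\<^sup>2 + 2 * (g x - h x)\<^sup>2)"
  proof (intro integral_mono)
    fix x
    have "(f x - h x)\<^sup>2 = ((f x - g x) + (g x - h x))\<^sup>2" by simp
    also have "\<dots> \<le> 2 * (f x - g x)\<^sup>2 + 2 * (g x - h x)\<^sup>2"
      using sum_squares_bound[of "f x - g x" "g x - h x"] unfolding power2_sum by linarith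
    finally show "(f x - h x)\<^sup>2 \<le> 2 * (f x - g x)\<^sup>2 + 2 * (g x - h x)\<^sup>2" .
  qed (use i in auto)
  also have "\<dots> = 2 * sq_dist f g + 2 * sq_dist g h"
    using i by (simp add: sq_dist_unif)
  finally show ?thesis .
qed

lemma L2_norm_diff: "L2_norm (\<lambda>x. f x - g x) = sqrt (sq_dist f g)"
  by (simp add: L2_norm_def sq_dist_def)

lemma measurable_sq_dist_step:
  assumes [measurable]: "f0 \<in> borel_measurable borel"
  shows "(\<lambda>\<theta>. sq_dist (step \<theta>) f0) \<in> borel_measurable (prior K kmax p \<pi>a \<pi>t)"
proof -
  let ?Q = "prior K kmax p \<pi>a \<pi>t"
  have [measurable]: "(\<lambda>w. step (fst w) (snd w)) \<in> borel_measurable (?Q \<Otimes>\<^sub>M unif)"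
    using measurable_step_prior by (simp add: case_prod_beta cong: measurable_cong_sets sets_pair_measure_cong)
  have "(\<lambda>\<theta>. LINT x|unif. (step \<theta> x - f0 x)\<^sup>2) \<in> borel_measurable ?Q"
    by (rule unif.borel_measurable_lebesgue_integral) (simp add: case_prod_beta)
  moreover have "step \<theta> \<in> borel_measurable borel" for \<theta>
    by (cases \<theta>) (simp add: measurable_step)
  ultimately show ?thesis by (simp add: sq_dist_unif)
qed

theorem theorem1:
  fixes K :: real and kmax k0 :: nat and p :: "nat \<Rightarrow> real"
    and \<pi>a :: "nat \<Rightarrow> (nat \<Rightarrow> real) \<Rightarrow> (nat \<Rightarrow> real) \<Rightarrow> real"
    and \<pi>t :: "nat \<Rightarrow> (nat \<Rightarrow> real) \<Rightarrow> real"
    and a0 t0 :: "nat \<Rightarrow> real" and \<theta>0 :: param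
  assumes "kmax \<ge> 1" and "K > 0"
    and "\<forall>k\<in>{1..kmax}. p k > 0" and "(\<Sum>k=1..kmax. p k) = 1"
    and "prior_densities K kmax \<pi>a \<pi>t"
    and "assumption_A K kmax \<pi>a \<pi>t"
    and "\<theta>0 = (k0, a0, t0)" and "\<theta>0 \<in> Theta K kmax"
    and "\<forall>j\<in>{2..k0}. a0 j \<noteq> a0 (j - 1)"
  shows "\<forall>\<^sub>F M :: real in at_top.
    tendsto_0_in_prob (data_law (step \<theta>0))
      (\<lambda>n z. posterior (prior K kmax p \<pi>a \<pi>t) n z
         {\<theta> \<in> Theta K kmax.
            L2_norm (\<lambda>x. step \<theta> x - step \<theta>0 x) > M * (sqrt (ln (real n)) / sqrt (real n))})"
proof -
  let ?Q = "prior K kmax p \<pi>a \<pi>t" and ?f0 = "step \<theta>0"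
  have Q: "prob_space ?Q" by (rule prob_space_prior[OF assms(5,3,4)])
  interpret Q: prob_space ?Q by (rule Q)
  have \<theta>0: "(k0, a0, t0) \<in> Theta K kmax" using assms(7,8) by simp
  obtain c q where c: "0 < c" and mass: "\<And>n. 1 \<le> n \<Longrightarrow> \<exists>B\<in>sets ?Q.
      c * (1 / real n) ^ q \<le> measure ?Q B \<and> (\<forall>\<theta>\<in>B. real n * sq_dist (step \<theta>) ?f0 \<le> 1)"
    using prior_mass_near[OF assms(2,3,5,6) Q \<theta>0] unfolding assms(7) by metis
  obtain R :: nat where R: "K + 2 \<le> real R" using real_arch_simple by blast
  \<comment> \<open>A common bound for all step functions of the model and for all net
    points.\<close>
  define L where "L = real kmax * real R"
  have f0_m [measurable]: "?f0 \<in> borel_measurable borel" unfolding assms(7) by measurable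
  have step_m: "step \<theta> \<in> borel_measurable borel" for \<theta>
    by (cases \<theta>) (simp add: measurable_step)
  have step_le: "\<bar>step \<theta> x\<bar> \<le> L" if T: "\<theta> \<in> Theta K kmax" for \<theta> x
  proof -
    obtain k a t where \<theta>: "\<theta> = (k, a, t)" "k \<le> kmax" "a \<in> heights K k"
      using T by (auto simp: Theta_def Theta_k_def)
    have "\<bar>step \<theta> x\<bar> \<le> real k * K"
      unfolding \<theta>(1) using \<theta>(3) by (intro abs_step_le) (auto simp: heights_def abs_le_iff dest!: PiE_mem)
    also have "\<dots> \<le> L" unfolding L_def using \<theta>(2) R assms(2) by (intro mult_mono) auto
    finally show ?thesis .
  qed
  \<comment> \<open>The decay \<open>n ^ (-m)\<close> has to beat \<open>n ^ (2 * kmax)\<close> from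
    the net and \<open>n ^ (q + 1)\<close> from the prior mass and \<open>T = n\<close>, with a
    factor \<open>1 / n\<close> to spare.\<close>
  define m where "m = 2 * kmax + q + 2"
  define r \<eta> where "r = affinity_rate L" and "\<eta> = affinity_radius L"
  have r: "0 < r" and \<eta>: "0 < \<eta>" by (simp_all add: r_def \<eta>_def affinity_rate_pos affinity_radius_pos)
  define C where "C = 10 * L\<^sup>2"
  have C: "0 \<le> C" by (simp add: C_def)
  \<comment> \<open>The second and third conditions on \<open>M\<close> make the net fine enough
    relative to the radius, and the fourth makes the exponent at least \<open>m * ln n\<close>. From
    \<open>n = 3\<close> on, \<open>ln n\<close> is at least 1.\<close>
  have tail: "measure (data_law ?f0 n) {z \<in> space (data_law ?f0 n). \<bar>posterior ?Q n z
        {\<theta> \<in> Theta K kmax. L2_norm (\<lambda>x. step \<theta> x - ?f0 x) > M * (sqrt (ln (real n)) / sqrt (real n))}\<bar> > \<delta>}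
      \<le> (exp (exp (4 * L\<^sup>2)) + real kmax * (3 * real R) ^ (2 * kmax) + 1 / (\<delta> * c)) / real n"
    if M: "1 \<le> M" "4 * C \<le> M\<^sup>2" "4 * C \<le> \<eta> * M\<^sup>2" "4 * real m \<le> r * M\<^sup>2" and \<delta>: "0 < \<delta>" and n: "3 \<le> n"
    for M \<delta> n
  proof -
    define A where "A = {\<theta> \<in> Theta K kmax. L2_norm (\<lambda>x. step \<theta> x - ?f0 x) > M * (sqrt (ln (real n)) / sqrt (real n))}"
    define s where "s = M\<^sup>2 * (ln (real n) / real n)"
    \<comment> \<open>\<open>s\<close> is the squared radius. If
      \<open>sq_dist (step \<theta>) g \<le> s / 4\<close>, the triangle bound
      \<open>s < 2 * (s / 4) + 2 * sq_dist g ?f0\<close> leaves \<open>s / 4\<close> for the net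
      point.\<close>
    define \<rho> where "\<rho> = s / 4"
    have n1: "1 \<le> n" and n0: "0 < real n" using n by auto
    have ln1: "1 \<le> ln (real n)"
    proof -
      have "exp 1 \<le> real n" using exp_le n by linarith
      then show ?thesis using n0 by (simp add: ln_ge_iff)
    qed
    have A: "A \<in> sets ?Q"
    proof -
      have [measurable]: "(\<lambda>\<theta>. sq_dist (step \<theta>) ?f0) \<in> borel_measurable ?Q"
        by (rule measurable_sq_dist_step) measurable
      have "A = {\<theta> \<in> space ?Q. M * (sqrt (ln (real n)) / sqrt (real n)) < sqrt (sq_dist (step \<theta>) ?f0)}"
        by (simp add: A_def space_prior L2_norm_diff)
      also have "\<dots> \<in> sets ?Q" by measurable
      finally show ?thesis .
    qed
    have As: "s < sq_dist (step \<theta>) ?f0" "\<theta> \<in> Theta K kmax" if "\<theta> \<in> A" for \<theta>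
    proof -
      have "M * (sqrt (ln (real n)) / sqrt (real n)) < sqrt (sq_dist (step \<theta>) ?f0)"
        using that by (simp add: A_def L2_norm_diff)
      moreover have "0 \<le> M * (sqrt (ln (real n)) / sqrt (real n))" using M ln1 by simp
      ultimately have "(M * (sqrt (ln (real n)) / sqrt (real n)))\<^sup>2 < (sqrt (sq_dist (step \<theta>) ?f0))\<^sup>2"
        by (intro power_strict_mono) auto
      then show "s < sq_dist (step \<theta>) ?f0"
        using ln1 by (simp add: s_def power_mult_distrib power_divide sq_dist_nonneg)
      show "\<theta> \<in> Theta K kmax" using that by (simp add: A_def)
    qed
    obtain G where G: "finite G" "real (card G) \<le> real kmax * (3 * real n * real R) ^ (2 * kmax)"
      "\<And>g. g \<in> G \<Longrightarrow> g \<in> borel_measurable borel"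
      "\<And>g x. g \<in> G \<Longrightarrow> \<bar>g x\<bar> \<le> L"
      "\<And>\<theta>. \<theta> \<in> Theta K kmax \<Longrightarrow> \<exists>g\<in>G. sq_dist (step \<theta>) g \<le> C / real n"
      using step_net[OF n1 assms(2) R, of kmax] unfolding L_def C_def by metis
    define G' where "G' = {g \<in> G. \<rho> \<le> sq_dist g ?f0}"
    have Cs: "C / real n \<le> s / 4" "C / real n \<le> \<eta> * \<rho>"
    proof -
      have ss: "M\<^sup>2 / real n \<le> s" using mult_left_mono[OF ln1, of "M\<^sup>2 / real n"] n0 by (simp add: s_def)
      have "4 * C / real n \<le> M\<^sup>2 / real n" using M(2) n0 by (intro divide_right_mono) auto
      from order_trans[OF this ss] have "4 * (C / real n) \<le> s" by (simp only: times_divide_eq_right)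
      then show "C / real n \<le> s / 4" by linarith
      have "4 * C / real n \<le> \<eta> * M\<^sup>2 / real n" using M(3) n0 by (intro divide_right_mono) auto
      also have "\<dots> \<le> \<eta> * s" using mult_left_mono[OF ss, of \<eta>] \<eta> by simp
      finally have "4 * (C / real n) \<le> \<eta> * s" by (simp only: times_divide_eq_right)
      moreover have "\<eta> * \<rho> = \<eta> * s / 4" by (simp add: \<rho>_def)
      ultimately show "C / real n \<le> \<eta> * \<rho>" by linarith
    qed
    have net: "\<exists>g\<in>G'. sq_dist (step \<theta>) g \<le> \<eta> * sq_dist g ?f0" if "\<theta> \<in> A" for \<theta>
    proof -
      note T = As(2)[OF that]
      obtain g where g: "g \<in> G" "sq_dist (step \<theta>) g \<le> C / real n" using G(5)[OF T] by blast
      have "s < 2 * sq_dist (step \<theta>) g + 2 * sq_dist g ?f0"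
        using As(1)[OF that] sq_dist_triangle[OF step_m G(3)[OF g(1)] f0_m step_le[OF T] G(4)[OF g(1)] step_le[OF assms(8)]]
        by (rule less_le_trans)
      then have far: "\<rho> \<le> sq_dist g ?f0" using g(2) Cs(1) unfolding \<rho>_def by linarith
      have "sq_dist (step \<theta>) g \<le> \<eta> * \<rho>" using g(2) Cs(2) by linarith
      also have "\<dots> \<le> \<eta> * sq_dist g ?f0" using far \<eta> by (intro mult_left_mono) auto
      finally show ?thesis using far g(1) by (auto simp: G'_def)
    qed
    obtain B where B: "B \<in> sets ?Q" "c * (1 / real n) ^ q \<le> measure ?Q B"
      "\<And>\<theta>. \<theta> \<in> B \<Longrightarrow> real n * sq_dist (step \<theta>) ?f0 \<le> 1"
      using mass[OF n1] by blast
    have Bpos: "0 < measure ?Q B"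
      using B(2) c n0 by (intro less_le_trans[OF _ B(2)]) simp
    \<comment> \<open>The choice \<open>T = n\<close> sends the first term to zero and costs only
      one further power of \<open>n\<close> in the last.\<close>
    have "measure (data_law ?f0 n) {z \<in> space (data_law ?f0 n). \<bar>posterior ?Q n z A\<bar> > \<delta>}
      \<le> exp (exp (4 * L\<^sup>2)) / real n
        + (card G' + real n / (\<delta> * measure ?Q B)) * exp (- (real n * affinity_rate L * \<rho>))"
    proof (rule posterior_tail_bound[OF Q measurable_step_prior _ f0_m step_le[OF assms(8)] A B(1)])
      show "finite G'" "\<And>g. g \<in> G' \<Longrightarrow> g \<in> borel_measurable borel" "\<And>g x. g \<in> G' \<Longrightarrow> \<bar>g x\<bar> \<le> L"
        "\<And>g. g \<in> G' \<Longrightarrow> \<rho> \<le> sq_dist g ?f0"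
        using G by (auto simp: G'_def)
      show "\<And>\<theta> x. \<theta> \<in> space ?Q \<Longrightarrow> \<bar>step \<theta> x\<bar> \<le> L" using step_le by (simp add: space_prior)
    qed (use net B(3) Bpos n0 \<delta> in \<open>auto simp: \<eta>_def\<close>)
    also have "\<dots> \<le> exp (exp (4 * L\<^sup>2)) / real n
        + (real kmax * (3 * real R) ^ (2 * kmax) * real n ^ (2 * kmax) + 1 / (\<delta> * c) * real n ^ (q + 1)) * (1 / real n) ^ m"
    proof (intro add_left_mono mult_mono add_mono)
      have "card G' \<le> card G" unfolding G'_def by (intro card_mono G(1)) auto
      then have "real (card G') \<le> real (card G)" by simp
      also note G(2)
      also have "real kmax * (3 * real n * real R) ^ (2 * kmax) = real kmax * (3 * real R) ^ (2 * kmax) * real n ^ (2 * kmax)"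
        by (simp add: power_mult_distrib)
      finally show "real (card G') \<le> real kmax * (3 * real R) ^ (2 * kmax) * real n ^ (2 * kmax)" .
      have "real n / (\<delta> * measure ?Q B) \<le> real n / (\<delta> * (c * (1 / real n) ^ q))"
        using B(2) \<delta> c n0 Bpos by (intro divide_left_mono mult_left_mono mult_pos_pos) auto
      also have "\<dots> = 1 / (\<delta> * c) * real n ^ (q + 1)"
        using n0 by (simp add: power_divide)
      finally show "real n / (\<delta> * measure ?Q B) \<le> 1 / (\<delta> * c) * real n ^ (q + 1)" .
      \<comment> \<open>In \<open>n * \<rho>\<close> the factor \<open>n\<close> cancels the
        \<open>1 / n\<close> of the squared radius and leaves a multiple of \<open>ln n\<close>, so
        the exponential bound is a power of \<open>1 / n\<close> whose degree grows with
        \<open>M\<close>.\<close>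
      have "real m * ln (real n) \<le> r * M\<^sup>2 / 4 * ln (real n)"
        using M(4) ln1 by (intro mult_right_mono) auto
      also have "\<dots> = real n * r * \<rho>" using n0 by (simp add: \<rho>_def s_def)
      finally have "exp (- (real n * affinity_rate L * \<rho>)) \<le> exp (- (real m * ln (real n)))"
        by (simp add: r_def)
      also have "\<dots> = (1 / real n) ^ m"
        using n0 by (simp add: exp_minus exp_of_nat_mult power_divide inverse_eq_divide)
      finally show "exp (- (real n * affinity_rate L * \<rho>)) \<le> (1 / real n) ^ m" .
    qed (use \<delta> c in auto)
    also have "\<dots> \<le> exp (exp (4 * L\<^sup>2)) / real n
        + (real kmax * (3 * real R) ^ (2 * kmax) * (1 / real n) + 1 / (\<delta> * c) * (1 / real n))"
    proof -
      have pw: "real n ^ i * (1 / real n) ^ m \<le> 1 / real n" if "i + 1 \<le> m" for i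
      proof -
        have "real n ^ i * (1 / real n) ^ m = (1 / real n) ^ (m - i)"
          using n0 that by (simp add: power_divide power_diff)
        also have "\<dots> \<le> (1 / real n) ^ 1" using that n1 by (intro power_decreasing) auto
        finally show ?thesis by simp
      qed
      show ?thesis
        unfolding distrib_right mult.assoc
        using \<delta> c by (intro add_left_mono add_mono mult_left_mono pw) (auto simp: m_def)
    qed
    also have "\<dots> = (exp (exp (4 * L\<^sup>2)) + real kmax * (3 * real R) ^ (2 * kmax) + 1 / (\<delta> * c)) / real n"
      by (simp add: add_divide_distrib)
    finally show ?thesis unfolding A_def .
  qed
  have lim: "tendsto_0_in_prob (data_law ?f0) (\<lambda>n z. posterior ?Q n z
      {\<theta> \<in> Theta K kmax. L2_norm (\<lambda>x. step \<theta> x - ?f0 x) > M * (sqrt (ln (real n)) / sqrt (real n))})"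
    if "1 \<le> M" "4 * C \<le> M\<^sup>2" "4 * C \<le> \<eta> * M\<^sup>2" "4 * real m \<le> r * M\<^sup>2" for M
    unfolding tendsto_0_in_prob_def
  proof (intro allI impI)
    fix \<delta> :: real assume \<delta>: "0 < \<delta>"
    show "(\<lambda>n. measure (data_law ?f0 n) {z \<in> space (data_law ?f0 n). \<bar>posterior ?Q n z
        {\<theta> \<in> Theta K kmax. L2_norm (\<lambda>x. step \<theta> x - ?f0 x) > M * (sqrt (ln (real n)) / sqrt (real n))}\<bar> > \<delta>})
        \<longlonglongrightarrow> 0"
    proof (rule tendsto_sandwich[OF _ _ tendsto_const lim_const_over_n])
      show "\<forall>\<^sub>F n in sequentially. measure (data_law ?f0 n) {z \<in> space (data_law ?f0 n). \<bar>posterior ?Q n z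
          {\<theta> \<in> Theta K kmax. L2_norm (\<lambda>x. step \<theta> x - ?f0 x) > M * (sqrt (ln (real n)) / sqrt (real n))}\<bar> > \<delta>}
          \<le> (exp (exp (4 * L\<^sup>2)) + real kmax * (3 * real R) ^ (2 * kmax) + 1 / (\<delta> * c)) / real n"
        using eventually_ge_at_top[of 3] by eventually_elim (rule tail[OF that \<delta>])
    qed simp
  qed
  \<comment> \<open>Every summand of the threshold is nonnegative, and \<open>M \<ge> 1\<close>
    gives \<open>M \<le> M\<^sup>2\<close>. One linear threshold thus yields all four conditions on
    \<open>M\<close>.\<close>
  show ?thesis
    using eventually_ge_at_top[of "1 + 4 * C + 4 * C / \<eta> + 4 * real m / r"]
  proof eventually_elim
    case (elim M)
    have nn: "0 \<le> 4 * C" "0 \<le> 4 * C / \<eta>" "0 \<le> 4 * real m / r" using C \<eta> r by auto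
    then have M: "1 \<le> M" using elim by linarith
    then have MM: "M \<le> M\<^sup>2" by (simp add: power2_eq_square)
    show ?case
    proof (rule lim[OF M])
      show "4 * C \<le> M\<^sup>2" using elim nn MM by linarith
      have "4 * C / \<eta> \<le> M\<^sup>2" "4 * real m / r \<le> M\<^sup>2" using elim nn MM by linarith+
      then show "4 * C \<le> \<eta> * M\<^sup>2" "4 * real m \<le> r * M\<^sup>2"
        using \<eta> r by (simp_all add: divide_le_eq mult.commute)
    qed
  qed
qed

end
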